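(* Assume that $Q=(q_0,q_1)\in(1,\infty)^2$ with $q_0+q_1\ge q_0q_1$. Let $I_Q=\left[0,\frac{1}{q_1-1}\right]$, and let $G,L:I_Q\to I_Q$ be the greedy and lazy maps. (i) There exist unique probability measures $\mu_{g,Q}$ and $\mu_{l,Q}$ on $I_Q$ that are invariant under $G$ and $L$, respectively. (ii) They are absolutely continuous with respect to the Lebesgue measure $m$, and their density functions $h_{g,Q}$ and $h_{l,Q}$ are bounded. Moreover, $h_{g,Q}$ is non-increasing, while $h_{l,Q}$ is non-decreasing. (iii) Finally, the dynamical systems $(I_Q,\Sigma_{I_Q},\mu_{g,Q},G)$ and $(I_Q,\Sigma_{I_Q},\mu_{l,Q},L)$ are exact.
   Context: The greedy map $G:I_Q\to I_Q$ is defined by $G(x)=q_0x$ if $x\in\left[0,\frac1{q_1}\right)$ and $G(x)=q_1x-1$ if $x\in\left[\frac1{q_1},\frac1{q_1-1}\right]$. The lazy map $L:I_Q\to I_Q$ is defined by $L(x)=q_0x$ if $x\in\left[0,\frac{1}{q_0(q_1-1)}\right]$ and $L(x)=q_1x-1$ if $x\in\left(\frac{1}{q_0(q_1-1)},\frac{1}{q_1-1}\right]$. $m$ denotes the Lebesgue measure on $I_Q$, and $\Sigma_{I_Q}$ the $\sigma$-algebra of measurable subsets of $I_Q$. A measure $\mu$ on $I_Q$ is invariant under a map $T:I_Q\to I_Q$ if $\mu(T^{-1}(E))=\mu(E)$ for all $E\in\Sigma_{I_Q}$. The density functions are $h_{g,Q}=d\mu_{g,Q}/dm$ and $h_{l,Q}=d\mu_{l,Q}/dm$.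 A dynamical system $(X,\Sigma,\mu,T)$ is called exact if $\bigcap_{n=1}^{\infty}\{T^{-n}(A): A\in\Sigma\}$ is trivial, i.e., it contains only sets of measure zero and their complements.
   Formalization: Uniqueness in (i) is stated only among invariant probability measures that are absolutely continuous with respect to m: G(0)=L(0)=0, so the Dirac measure at 0 is always invariant under both maps and uniqueness among all invariant probability measures fails. *)

theory Defs
  imports "HOL-Probability.Probability"
begin

definition I_Q :: "real \<Rightarrow> real set" where
  "I_Q q1 = {0..1 / (q1 - 1)}"

text \<open>The maps are total functions on the reals; they are only used on I_Q, which they leave
  invariant (see the lemmas below).\<close>

definition greedy_map :: "real \<Rightarrow> real \<Rightarrow> real \<Rightarrow> real" where
  "greedy_map q0 q1 x = (if x < 1 / q1 then q0 * x else q1 * x - 1)"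

definition lazy_map :: "real \<Rightarrow> real \<Rightarrow> real \<Rightarrow> real" where
  "lazy_map q0 q1 x = (if x \<le> 1 / (q0 * (q1 - 1)) then q0 * x else q1 * x - 1)"

definition invariant_under :: "'a measure \<Rightarrow> ('a \<Rightarrow> 'a) \<Rightarrow> bool" where
  "invariant_under M T \<longleftrightarrow>
     T \<in> measurable M M \<and> (\<forall>E\<in>sets M. emeasure M (T -` E \<inter> space M) = emeasure M E)"

definition invariant_prob_on :: "real set \<Rightarrow> (real \<Rightarrow> real) \<Rightarrow> real measure \<Rightarrow> bool" where
  "invariant_prob_on I T \<mu> \<longleftrightarrow>
     sets \<mu> = sets (lebesgue_on I) \<and> prob_space \<mu> \<and> invariant_under \<mu> T"

text \<open>A density is determined only up to null sets, so \<open>is_density M N h\<close> says that \<open>h\<close> is a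
  (finite, everywhere nonnegative) version of the Radon-Nikodym derivative of N with respect to M.\<close>

definition is_density :: "'a measure \<Rightarrow> 'a measure \<Rightarrow> ('a \<Rightarrow> real) \<Rightarrow> bool" where
  "is_density M N h \<longleftrightarrow>
     h \<in> borel_measurable M \<and> (\<forall>x\<in>space M. 0 \<le> h x) \<and> N = density M (\<lambda>x. ennreal (h x))"

definition exact_system :: "'a measure \<Rightarrow> ('a \<Rightarrow> 'a) \<Rightarrow> bool" where
  "exact_system M T \<longleftrightarrow>
     (\<forall>B \<in> (\<Inter>n\<in>{1..}. {(T ^^ n) -` A \<inter> space M | A. A \<in> sets M}).
        B \<in> null_sets M \<or> space M - B \<in> null_sets M)"

lemma greedy_map_in_I_Q:
  assumes "1 < q0" "1 < q1" "q0 * q1 \<le> q0 + q1" "x \<in> I_Q q1"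
  shows "greedy_map q0 q1 x \<in> I_Q q1"
proof (cases "x < 1 / q1")
  case True
  have "q0 * x * (q1 - 1) \<le> q0 * (1 / q1) * (q1 - 1)"
    using True assms by (intro mult_right_mono mult_left_mono) auto
  also have "\<dots> \<le> 1"
    using assms by (simp add: field_simps)
  finally show ?thesis
    using True assms by (simp add: greedy_map_def I_Q_def pos_le_divide_eq)
next
  case False
  have "q1 * x - 1 \<le> x" "1 / q1 \<le> x"
    using False assms by (simp_all add: I_Q_def field_simps)
  then show ?thesis
    using False assms by (auto simp: greedy_map_def I_Q_def pos_divide_le_eq mult.commute)
qed

lemma lazy_map_in_I_Q:
  assumes "1 < q0" "1 < q1" "q0 * q1 \<le> q0 + q1" "x \<in> I_Q q1"
  shows "lazy_map q0 q1 x \<in> I_Q q1"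
proof (cases "x \<le> 1 / (q0 * (q1 - 1))")
  case True
  then show ?thesis
    using assms by (simp add: lazy_map_def I_Q_def field_simps)
next
  case False
  have "1 / q1 \<le> 1 / (q0 * (q1 - 1))"
    using assms by (intro divide_left_mono) (auto simp: algebra_simps)
  then have "1 / q1 \<le> x"
    using False by linarith
  moreover have "q1 * x - 1 \<le> x"
    using assms by (simp add: I_Q_def field_simps)
  ultimately show ?thesis
    using False assms by (auto simp: lazy_map_def I_Q_def pos_divide_le_eq mult.commute)
qed

text \<open>Both maps fix 0, so the Dirac measure at 0 is always invariant; hence uniqueness of the
  invariant probability measure can only hold among the absolutely continuous ones.\<close>

lemma invariant_under_return:
  assumes "T \<in> measurable M M" "x \<in> space M" "T x = x"
  shows "invariant_under (return M x) T"
  using assms by (auto simp: invariant_under_def measurable_sets indicator_def)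

lemma greedy_map_0: "1 < q1 \<Longrightarrow> greedy_map q0 q1 0 = 0"
  by (simp add: greedy_map_def)

lemma lazy_map_0: "1 < q0 \<Longrightarrow> 1 < q1 \<Longrightarrow> lazy_map q0 q1 0 = 0"
  by (simp add: lazy_map_def)

end

theory Submission
  imports Defs
begin

text \<open>Write \<open>b = 1 / (q1 - 1)\<close>, so that the interval is \<open>[0, b]\<close>, and \<open>r = q0 / q1\<close>.

Both branches of the greedy map \<open>G\<close> are increasing and affine, and both start at the value \<open>0\<close>.
Hence the push-forward of the uniform distribution \<open>U a\<close> on \<open>[0, a)\<close> is again a mixture of such
distributions: it is \<open>U (q0 * a)\<close> if \<open>a \<le> 1 / q1\<close>, and otherwise it is \<open>U r\<close> with
probability \<open>1 / (q1 * a)\<close> and \<open>U (q1 * a - 1)\<close> with the complementary probability.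
On uniform distributions, \<open>G\<close> is therefore a Markov chain whose states are the right endpoints
\<open>a\<close>. This chain renews itself at the state \<open>r\<close>.

Exactness. Let \<open>B\<close> be a tail set and \<open>A n = G^n B\<close>, so that \<open>A n\<close> is the preimage of
\<open>A (n + 1)\<close>. The proportion \<open>\<phi> n a\<close> of \<open>A n\<close> in \<open>[0, a)\<close> is a bounded space-time harmonic function
of the endpoint chain. From every state the chain soon has a chance to jump to \<open>r\<close>, with a
probability bounded below, so extreme values of \<open>\<phi>\<close> are approached at \<open>r\<close>; and it stays at \<open>r\<close> with probability
\<open>1 / q0 > 0\<close>, so an almost extreme value of a harmonic function at \<open>r\<close> persists for a long time.
Applied to the time difference of \<open>\<phi>\<close>, whose sums over time are bounded, this forces \<open>\<phi>\<close> to be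
independent of time, and then constant, as in the Choquet-Deny theorem
(\<open>harmonic_constant\<close>). So \<open>B\<close> fills the same proportion \<open>\<theta>\<close> of every \<open>[0, a)\<close>, hence of every
measurable set, and in particular of itself, which leaves only \<open>\<theta> = 0\<close> and \<open>\<theta> = 1\<close>
(\<open>lebesgue_proportional_imp_zero_one\<close>). This proves exactness for Lebesgue measure
(\<open>exact_lebesgue_G\<close>), and exactness passes to every absolutely continuous measure.

Uniqueness. If \<open>Y\<close> is a Hahn set for the difference of two invariant probability measures, then
all preimages of \<open>Y\<close> maximize that difference, and so does their upper limit. The upper limit is
a tail set, on which two absolutely continuous probability measures agree by exactness; the
maximum is therefore \<open>0\<close> (\<open>exact_imp_unique_invariant_prob\<close>).

Existence. Start at the endpoint \<open>r\<close> and follow the moves of the chain that do not jump to \<open>r\<close>.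
If \<open>a n\<close> are the endpoints and \<open>w n\<close> the products of the reciprocal slopes, the function
\<open>\<Sum>n. w n * indicator [0, a n)\<close> is bounded and non-increasing. Its push-forward has the same
terms without the first one, plus a multiple of \<open>indicator [0, r)\<close>; since total mass is
preserved, this multiple is exactly the missing first term (\<open>greedy_invariant_density\<close>).

The lazy map. The decreasing affine bijection from the interval for \<open>(q0, q1)\<close> to the one for
\<open>(q1, q0)\<close> conjugates the lazy map for \<open>(q0, q1)\<close> to the greedy map for \<open>(q1, q0)\<close>, and the
hypotheses are symmetric in \<open>q0\<close> and \<open>q1\<close>. Reversing the order turns a non-increasing density
into a non-decreasing one.\<close>

section \<open>Tail sets and exactness\<close>

definition tail_set :: "'a measure \<Rightarrow> ('a \<Rightarrow> 'a) \<Rightarrow> 'a set \<Rightarrow> bool" where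
  "tail_set M T B \<longleftrightarrow> (\<forall>n\<ge>1. \<exists>A\<in>sets M. B = (T ^^ n) -` A \<inter> space M)"

lemma exact_system_iff_tail_set:
  "exact_system M T \<longleftrightarrow>
     (\<forall>B. tail_set M T B \<longrightarrow> B \<in> null_sets M \<or> space M - B \<in> null_sets M)"
proof -
  have "B \<in> (\<Inter>n\<in>{1..}. {(T ^^ n) -` A \<inter> space M | A. A \<in> sets M}) \<longleftrightarrow> tail_set M T B" for B
    by (simp only: tail_set_def INT_iff atLeast_iff mem_Collect_eq Ball_def Bex_def) blast
  then show ?thesis
    unfolding exact_system_def Ball_def by (simp only:)
qed

lemma tail_set_cong:
  assumes "sets N = sets M"
  shows "tail_set N T B \<longleftrightarrow> tail_set M T B"
  using assms sets_eq_imp_space_eq[OF assms] by (simp add: tail_set_def)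

lemma exact_system_absolutely_continuous:
  assumes "exact_system M T" "absolutely_continuous M N" "sets N = sets M"
  shows "exact_system N T"
  using assms sets_eq_imp_space_eq[OF assms(3)] tail_set_cong[OF assms(3)]
  unfolding exact_system_iff_tail_set absolutely_continuous_def by auto

lemma tail_set_measurable:
  assumes "T \<in> M \<rightarrow>\<^sub>M M" "tail_set M T B"
  shows "B \<in> sets M"
proof -
  obtain A where "A \<in> sets M" "B = (T ^^ 1) -` A \<inter> space M"
    using assms(2) unfolding tail_set_def by blast
  then show ?thesis
    using measurable_sets[OF assms(1)] by simp
qed

lemma funpow_semiconjugacy:
  assumes "\<And>y. y \<in> X \<Longrightarrow> S y \<in> X" "\<And>y. y \<in> X \<Longrightarrow> T (\<pi> y) = \<pi> (S y)" "y \<in> X"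
  shows "(S ^^ n) y \<in> X \<and> (T ^^ n) (\<pi> y) = \<pi> ((S ^^ n) y)"
  by (induction n) (auto simp: assms)

text \<open>The preimage under \<open>\<pi>\<close> of a tail set of \<open>T\<close> is a tail set of \<open>S\<close>, because \<open>\<pi>\<close> also intertwines the
iterates. Used to carry exactness through the conjugacy between lazy and greedy maps.\<close>

lemma exact_system_factor:
  assumes pi: "\<pi> \<in> M \<rightarrow>\<^sub>M N" and T: "T \<in> N \<rightarrow>\<^sub>M N" and S: "S \<in> M \<rightarrow>\<^sub>M M"
    and commute: "\<And>y. y \<in> space M \<Longrightarrow> T (\<pi> y) = \<pi> (S y)"
    and exact: "exact_system M S"
  shows "exact_system (distr M N \<pi>) T"
  unfolding exact_system_iff_tail_set
proof (intro allI impI)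
  fix B assume "tail_set (distr M N \<pi>) T B"
  then have B: "tail_set N T B"
    using tail_set_cong[OF sets_distr] by blast
  then have B_sets: "B \<in> sets N"
    using T by (rule tail_set_measurable[rotated])
  have iterate: "(S ^^ n) y \<in> space M \<and> (T ^^ n) (\<pi> y) = \<pi> ((S ^^ n) y)"
    if "y \<in> space M" for n y
    using measurable_space[OF S] commute that by (rule funpow_semiconjugacy)
  have "tail_set M S (\<pi> -` B \<inter> space M)"
    unfolding tail_set_def
  proof (intro allI impI)
    fix n :: nat assume "n \<ge> 1"
    then obtain A where A: "A \<in> sets N" "B = (T ^^ n) -` A \<inter> space N"
      using B unfolding tail_set_def by blast
    have "\<pi> -` B \<inter> space M = (S ^^ n) -` (\<pi> -` A \<inter> space M) \<inter> space M"
      using iterate measurable_space[OF pi] by (auto simp: A(2))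
    then show "\<exists>A'\<in>sets M. \<pi> -` B \<inter> space M = (S ^^ n) -` A' \<inter> space M"
      using measurable_sets[OF pi A(1)] by blast
  qed
  then have "\<pi> -` B \<inter> space M \<in> null_sets M \<or> space M - \<pi> -` B \<inter> space M \<in> null_sets M"
    using exact unfolding exact_system_iff_tail_set by blast
  moreover have "space M - \<pi> -` B \<inter> space M = \<pi> -` (space N - B) \<inter> space M"
    using measurable_space[OF pi] by auto
  ultimately show "B \<in> null_sets (distr M N \<pi>) \<or> space (distr M N \<pi>) - B \<in> null_sets (distr M N \<pi>)"
    using B_sets pi by (auto simp: null_sets_distr_iff)
qed

lemma invariant_under_factor:
  assumes pi: "\<pi> \<in> M \<rightarrow>\<^sub>M N" and T: "T \<in> N \<rightarrow>\<^sub>M N"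
    and commute: "\<And>y. y \<in> space M \<Longrightarrow> T (\<pi> y) = \<pi> (S y)"
    and inv: "invariant_under M S"
  shows "invariant_under (distr M N \<pi>) T"
  unfolding invariant_under_def
proof (intro conjI ballI)
  have S: "S \<in> M \<rightarrow>\<^sub>M M"
    using inv by (simp add: invariant_under_def)
  show "T \<in> distr M N \<pi> \<rightarrow>\<^sub>M distr M N \<pi>"
    using T by simp
  fix E assume "E \<in> sets (distr M N \<pi>)"
  then have E: "E \<in> sets N"
    by simp
  have "emeasure (distr M N \<pi>) (T -` E \<inter> space N) = emeasure M (\<pi> -` (T -` E \<inter> space N) \<inter> space M)"
    using pi measurable_sets[OF T E] by (rule emeasure_distr)
  also have "\<pi> -` (T -` E \<inter> space N) \<inter> space M = S -` (\<pi> -` E \<inter> space M) \<inter> space M"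
    using commute measurable_space[OF pi] measurable_space[OF S] by auto
  also have "emeasure M \<dots> = emeasure M (\<pi> -` E \<inter> space M)"
    using inv measurable_sets[OF pi E] unfolding invariant_under_def by blast
  also have "\<dots> = emeasure (distr M N \<pi>) E"
    using pi E by (simp add: emeasure_distr)
  finally show "emeasure (distr M N \<pi>) (T -` E \<inter> space (distr M N \<pi>)) = emeasure (distr M N \<pi>) E"
    by simp
qed

text \<open>Whether an orbit visits \<open>Y\<close> infinitely often does not depend on its first \<open>n\<close> points, so this
upper limit of the preimages of \<open>Y\<close> is its own preimage under every iterate.\<close>

lemma tail_set_frequently:
  assumes T: "T \<in> M \<rightarrow>\<^sub>M M" and Y: "Y \<in> sets M"
  shows "tail_set M T {x \<in> space M. \<exists>\<^sub>F k in sequentially. (T ^^ k) x \<in> Y}" (is "tail_set M T ?C")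
  unfolding tail_set_def
proof (intro allI impI)
  have iter: "(T ^^ k) \<in> M \<rightarrow>\<^sub>M M" for k
    using T by (rule measurable_compose_n)
  have "?C \<in> sets M"
  proof -
    have "?C = (\<Inter>n. \<Union>k\<in>{n..}. (T ^^ k) -` Y \<inter> space M)"
      unfolding frequently_sequentially by (auto simp: Bex_def)
    also have "\<dots> \<in> sets M"
    proof (rule sets.countable_INT)
      have "(\<Union>k\<in>{n..}. (T ^^ k) -` Y \<inter> space M) \<in> sets M" for n
        using measurable_sets[OF iter Y] by (intro sets.countable_UN') auto
      then show "range (\<lambda>n. \<Union>k\<in>{n..}. (T ^^ k) -` Y \<inter> space M) \<subseteq> sets M"
        by blast
    qed simp
    finally show ?thesis .
  qed
  moreover fix n :: nat
  have "(\<exists>\<^sub>F k in sequentially. (T ^^ k) ((T ^^ n) x) \<in> Y) \<longleftrightarrow>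
        (\<exists>\<^sub>F k in sequentially. (T ^^ k) x \<in> Y)" for x
    using eventually_sequentially_seg[of "\<lambda>k. (T ^^ k) x \<notin> Y" n]
    by (simp add: frequently_def funpow_add)
  then have "?C = (T ^^ n) -` ?C \<inter> space M"
    using measurable_space[OF iter] by auto
  ultimately show "\<exists>A\<in>sets M. ?C = (T ^^ n) -` A \<inter> space M"
    by blast
qed

lemma surj_funpow_on: "T ` X = X \<Longrightarrow> (T ^^ n) ` X = X"
  by (induction n) (simp_all flip: image_image add: image_comp[symmetric])

text \<open>For a surjective map a set \<open>A\<close> is determined by its preimage under \<open>T ^^ n\<close>. The sets \<open>A\<close> in the
definition of a tail set are therefore the forward images of \<open>B\<close>, and each of them is the
preimage of the next.\<close>

lemma tail_set_forward_images:
  assumes T: "T \<in> M \<rightarrow>\<^sub>M M" and surj: "T ` space M = space M" and B: "tail_set M T B"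
  shows "(T ^^ n) ` B \<in> sets M" "(T ^^ n) ` B = T -` ((T ^^ Suc n) ` B) \<inter> space M"
proof -
  have onto: "(T ^^ n) ` space M = space M" for n
    using surj by (rule surj_funpow_on)
  have images: "(T ^^ n) ` B \<in> sets M \<and> B = (T ^^ n) -` ((T ^^ n) ` B) \<inter> space M" for n
  proof (cases "n = 0")
    case True
    then show ?thesis
      using tail_set_measurable[OF T B] sets.sets_into_space by fastforce
  next
    case False
    then have "1 \<le> n"
      by simp
    then obtain A where A: "A \<in> sets M" "B = (T ^^ n) -` A \<inter> space M"
      using B unfolding tail_set_def by blast
    have "(T ^^ n) ` B = A \<inter> (T ^^ n) ` space M"
      unfolding A(2) by auto
    then have "(T ^^ n) ` B = A"
      using sets.sets_into_space[OF A(1)] onto[of n] by (simp add: Int_absorb2)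
    then show ?thesis
      using A by simp
  qed
  then show "(T ^^ n) ` B \<in> sets M"
    by blast
  show "(T ^^ n) ` B = T -` ((T ^^ Suc n) ` B) \<inter> space M"
  proof (intro set_eqI iffI)
    fix y assume "y \<in> (T ^^ n) ` B"
    then show "y \<in> T -` ((T ^^ Suc n) ` B) \<inter> space M"
      using onto[of n] images[of 0] by auto
  next
    fix y assume y: "y \<in> T -` ((T ^^ Suc n) ` B) \<inter> space M"
    then obtain x where x: "x \<in> space M" "y = (T ^^ n) x"
      using onto[of n] by blast
    then have "(T ^^ Suc n) x \<in> (T ^^ Suc n) ` B"
      using y by auto
    then have "x \<in> B"
      using images[of "Suc n"] x(1) by blast
    then show "y \<in> (T ^^ n) ` B"
      using x(2) by blast
  qed
qed

section \<open>Uniqueness of absolutely continuous invariant measures\<close>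

text \<open>A Hahn set \<open>Y\<close> maximizes \<open>d X = measure N X - measure M X\<close>. By invariance its preimages are
maximizers too, finite unions of maximizers are maximizers since \<open>d\<close> is modular, and monotone limits
are harmless for finite measures; so the upper limit \<open>C\<close> of the preimages is a maximizer. But \<open>C\<close> is
a tail set, hence null or conull for both measures, and the maximum \<open>d C\<close> is \<open>0\<close>.\<close>

lemma exact_imp_invariant_prob_le:
  assumes exact: "exact_system L T" and T: "T \<in> L \<rightarrow>\<^sub>M L"
    and M: "prob_space M" "sets M = sets L" "invariant_under M T" "absolutely_continuous L M"
    and N: "prob_space N" "sets N = sets L" "invariant_under N T" "absolutely_continuous L N"
    and E: "E \<in> sets L"
  shows "measure N E \<le> measure M E"
proof -
  interpret M: prob_space M by fact
  interpret N: prob_space N by fact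
  note [simp] = M(2) N(2)
  have [simp]: "space M = space L" "space N = space L"
    using sets_eq_imp_space_eq[OF M(2)] sets_eq_imp_space_eq[OF N(2)] by simp_all
  define d where "d X = measure N X - measure M X" for X
  have iter: "(T ^^ k) \<in> L \<rightarrow>\<^sub>M L" for k
    using T by (rule measurable_compose_n)
  obtain Y where Y: "Y \<in> sets L"
    and ge_on_Y: "\<And>X. X \<in> sets L \<Longrightarrow> X \<subseteq> Y \<Longrightarrow> emeasure M X \<le> emeasure N X"
    and le_off_Y: "\<And>X. X \<in> sets L \<Longrightarrow> X \<inter> Y = {} \<Longrightarrow> emeasure N X \<le> emeasure M X"
    using finite_unsigned_Hahn_decomposition[OF N.finite_measure_axioms M.finite_measure_axioms]
    by auto
  have d_le: "d X \<le> d Y" if X: "X \<in> sets L" for X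
  proof -
    have "measure N (X - Y) \<le> measure M (X - Y)"
      using le_off_Y[of "X - Y"] X Y
      by (auto simp: M.emeasure_eq_measure N.emeasure_eq_measure)
    moreover have "measure M (Y - X) \<le> measure N (Y - X)"
      using ge_on_Y[of "Y - X"] X Y
      by (auto simp: M.emeasure_eq_measure N.emeasure_eq_measure)
    moreover have "measure N X = measure N (X - Y) + measure N (X \<inter> Y)"
      "measure M X = measure M (X - Y) + measure M (X \<inter> Y)"
      "measure N Y = measure N (Y - X) + measure N (X \<inter> Y)"
      "measure M Y = measure M (Y - X) + measure M (X \<inter> Y)"
      using X Y by (simp_all add: M.finite_measure_Diff' N.finite_measure_Diff' Int_commute)
    ultimately show ?thesis
      by (simp add: d_def)
  qed
  have d_Un: "d (X \<union> X') = d Y"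
    if X: "X \<in> sets L" "X' \<in> sets L" "d X = d Y" "d X' = d Y" for X X'
  proof -
    have "d (X \<union> X') + d (X \<inter> X') = d X + d X'"
      using X by (simp add: d_def M.finite_measure_Union' N.finite_measure_Union'
          M.finite_measure_Diff' N.finite_measure_Diff' Int_commute)
    moreover have "d (X \<union> X') \<le> d Y" "d (X \<inter> X') \<le> d Y"
      using X by (auto intro!: d_le)
    ultimately show ?thesis
      using X by linarith
  qed
  have d_step: "d (T -` X \<inter> space L) = d X" if "X \<in> sets L" for X
    using M(3) N(3) that by (simp add: d_def invariant_under_def measure_def)
  have d_iter: "d ((T ^^ k) -` X \<inter> space L) = d X" if X: "X \<in> sets L" for k X
  proof (induction k)
    case 0
    show ?case
      using X sets.sets_into_space[OF X] by (simp add: Int_absorb2)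
  next
    case (Suc k)
    have "(T ^^ Suc k) -` X \<inter> space L = T -` ((T ^^ k) -` X \<inter> space L) \<inter> space L"
      using measurable_space[OF T] by (auto simp: funpow_swap1)
    then show ?case
      using Suc d_step[OF measurable_sets[OF iter X]] by (simp del: funpow.simps)
  qed
  define V where "V n = (\<Union>k\<in>{..n}. (T ^^ k) -` Y \<inter> space L)" for n
  define Z where "Z = (\<Union>n. V n)"
  define C where "C = (\<Inter>n. (T ^^ n) -` Z \<inter> space L)"
  have V_sets: "V n \<in> sets L" for n
    unfolding V_def using measurable_sets[OF iter Y] by (intro sets.countable_UN') auto
  have Z_sets: "Z \<in> sets L"
    unfolding Z_def using V_sets by blast
  have d_V: "d (V n) = d Y" for n
  proof (induction n)
    case 0
    show ?case
      using d_iter[OF Y, of 0] by (simp add: V_def)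
  next
    case (Suc n)
    have "V (Suc n) = V n \<union> ((T ^^ Suc n) -` Y \<inter> space L)"
      by (auto simp: V_def atMost_Suc simp del: funpow.simps)
    then show ?case
      using d_Un[OF V_sets measurable_sets[OF iter Y] Suc d_iter[OF Y]] by (simp del: funpow.simps)
  qed
  have incseq_V: "incseq V"
    unfolding V_def by (intro incseq_SucI) (simp add: atMost_Suc)
  have "(\<lambda>n. d (V n)) \<longlonglongrightarrow> d Z"
    unfolding d_def Z_def using V_sets incseq_V
    by (intro tendsto_diff M.finite_Lim_measure_incseq N.finite_Lim_measure_incseq)
      (simp_all add: image_subset_iff)
  then have d_Z: "d Z = d Y"
    unfolding d_V by (simp add: LIMSEQ_const_iff)
  have Z_eq: "Z = {x \<in> space L. \<exists>k. (T ^^ k) x \<in> Y}"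
    by (auto simp: Z_def V_def)
  have orbit_Z: "(T ^^ n) -` Z \<inter> space L = {x \<in> space L. \<exists>k\<ge>n. (T ^^ k) x \<in> Y}" for n
  proof -
    have "(\<exists>k. (T ^^ k) ((T ^^ n) x) \<in> Y) \<longleftrightarrow> (\<exists>k\<ge>n. (T ^^ k) x \<in> Y)" for x
      unfolding le_iff_add by (auto simp: funpow_add add.commute[of n])
    then show ?thesis
      using measurable_space[OF iter, of _ n] by (auto simp: Z_eq)
  qed
  have decseq_Z: "decseq (\<lambda>n. (T ^^ n) -` Z \<inter> space L)"
    unfolding orbit_Z by (intro decseq_SucI) (auto intro: Suc_leD)
  have "(\<lambda>n. d ((T ^^ n) -` Z \<inter> space L)) \<longlonglongrightarrow> d C"
    unfolding d_def C_def using measurable_sets[OF iter Z_sets] decseq_Z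
    by (intro tendsto_diff M.finite_Lim_measure_decseq N.finite_Lim_measure_decseq)
      (simp_all add: image_subset_iff)
  then have d_C: "d C = d Y"
    unfolding d_iter[OF Z_sets] d_Z by (simp add: LIMSEQ_const_iff)
  have "C = {x \<in> space L. \<exists>\<^sub>F k in sequentially. (T ^^ k) x \<in> Y}"
    unfolding C_def orbit_Z frequently_sequentially by auto
  then have "tail_set L T C"
    using tail_set_frequently[OF T Y] by simp
  then have "C \<in> null_sets L \<or> space L - C \<in> null_sets L"
    using exact unfolding exact_system_iff_tail_set by blast
  moreover have C_sets: "C \<in> sets L"
    using tail_set_measurable[OF T] \<open>tail_set L T C\<close> .
  ultimately have "d C = 0"
  proof (elim disjE)
    assume "C \<in> null_sets L"
    then have "C \<in> null_sets M" "C \<in> null_sets N"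
      using M(4) N(4) by (auto simp: absolutely_continuous_def)
    then show ?thesis
      by (simp add: d_def measure_eq_0_null_sets)
  next
    assume "space L - C \<in> null_sets L"
    then have "space M - C \<in> null_sets M" "space N - C \<in> null_sets N"
      using M(4) N(4) by (auto simp: absolutely_continuous_def)
    then have "measure M C = 1" "measure N C = 1"
      using M.prob_compl[of C] N.prob_compl[of C] C_sets
      by (simp_all add: measure_eq_0_null_sets)
    then show ?thesis
      by (simp add: d_def)
  qed
  then show ?thesis
    using d_le[OF E] d_C by (simp add: d_def)
qed

lemma exact_imp_unique_invariant_prob:
  assumes exact: "exact_system L T" and T: "T \<in> L \<rightarrow>\<^sub>M L"
    and M: "prob_space M" "sets M = sets L" "invariant_under M T" "absolutely_continuous L M"
    and N: "prob_space N" "sets N = sets L" "invariant_under N T" "absolutely_continuous L N"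
  shows "M = N"
proof (rule measure_eqI)
  interpret M: prob_space M by fact
  interpret N: prob_space N by fact
  show "sets M = sets N"
    by (simp add: M(2) N(2))
  fix E assume "E \<in> sets M"
  then have "E \<in> sets L"
    by (simp add: M(2))
  then have "measure M E = measure N E"
    using exact_imp_invariant_prob_le[OF exact T M N] exact_imp_invariant_prob_le[OF exact T N M]
    by (simp add: order_antisym)
  then show "emeasure M E = emeasure N E"
    by (simp add: M.emeasure_eq_measure N.emeasure_eq_measure)
qed

section \<open>Lebesgue measure under affine maps\<close>

lemma measurable_affine_lebesgue:
  fixes c t :: real
  assumes "c \<noteq> 0"
  shows "(\<lambda>x. c * x + t) \<in> lebesgue \<rightarrow>\<^sub>M lebesgue"
  using lebesgue_affine_measurable[of "\<lambda>_. c" t] assms by (simp add: add.commute)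

lemma vimage_affine_eq_image:
  fixes c t :: real
  assumes "c \<noteq> 0"
  shows "(\<lambda>x. c * x + t) -` S = (\<lambda>y. (1 / c) *\<^sub>R y + - t / c) ` S"
proof -
  have "x = (1 / c) *\<^sub>R (c * x + t) + - t / c" "c * ((1 / c) *\<^sub>R x + - t / c) + t = x" for x
    using assms by (simp_all add: field_simps)
  then show ?thesis
    by (auto simp del: real_scaleR_def intro!: image_eqI)
qed

lemma emeasure_lebesgue_affine_vimage:
  fixes c t :: real
  assumes "c \<noteq> 0"
  shows "emeasure lebesgue ((\<lambda>x. c * x + t) -` S) = ennreal (1 / \<bar>c\<bar>) * emeasure lebesgue S"
  unfolding vimage_affine_eq_image[OF assms] emeasure_lebesgue_affine by simp

lemma measure_lebesgue_affine_vimage: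
  fixes c t :: real
  assumes "c \<noteq> 0"
  shows "measure lebesgue ((\<lambda>x. c * x + t) -` S) = measure lebesgue S / \<bar>c\<bar>"
  unfolding vimage_affine_eq_image[OF assms] measure_lebesgue_affine by simp

lemma sets_lebesgue_affine_vimage:
  fixes c t :: real
  assumes "c \<noteq> 0" "A \<in> sets lebesgue"
  shows "(\<lambda>x. c * x + t) -` A \<in> sets lebesgue"
  using measurable_sets[OF measurable_affine_lebesgue[OF assms(1)] assms(2), of t] by simp

lemma lmeasurable_affine_vimage:
  fixes c t :: real
  assumes "c \<noteq> 0" "A \<in> lmeasurable"
  shows "(\<lambda>x. c * x + t) -` A \<in> lmeasurable"
  using assms sets_lebesgue_affine_vimage[of c A t] emeasure_lebesgue_affine_vimage[of c t A]
  by (auto simp: fmeasurable_def ennreal_mult_less_top)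

lemma sets_lebesgue_on_I_Q: "A \<in> sets (lebesgue_on (I_Q q)) \<longleftrightarrow> A \<subseteq> I_Q q \<and> A \<in> sets lebesgue"
  by (subst sets_restrict_space_iff) (auto simp: I_Q_def)

lemma emeasure_lebesgue_on_I_Q:
  "A \<subseteq> I_Q q \<Longrightarrow> emeasure (lebesgue_on (I_Q q)) A = emeasure lebesgue A"
  by (subst emeasure_restrict_space) (auto simp: I_Q_def)

lemma null_sets_lebesgue_on_I_Q:
  "A \<in> null_sets (lebesgue_on (I_Q q)) \<longleftrightarrow> A \<subseteq> I_Q q \<and> A \<in> null_sets lebesgue"
  by (subst null_sets_restrict_space) (auto simp: I_Q_def)

section \<open>A zero-one law on an interval\<close>

text \<open>Proportionality on the segments \<open>[0, a)\<close> determines the measure of \<open>S\<close> on all half-lines, the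
generating sets on which two measures are compared below.\<close>

lemma borel_tail_measure_of_proportional:
  fixes b \<theta> :: real
  assumes S: "S \<in> sets borel" "S \<subseteq> {0..<b}" and b: "0 < b"
    and seg: "\<And>a. 0 < a \<Longrightarrow> a \<le> b \<Longrightarrow> measure lborel (S \<inter> {0..<a}) = \<theta> * a"
  shows "emeasure lborel (S \<inter> {x<..}) = ennreal (\<theta> * (b - min b (max 0 x)))"
proof -
  have finite: "emeasure lborel X \<noteq> \<infinity>" if "X \<subseteq> S" for X
  proof -
    have "X \<subseteq> {0..b}"
      using that S(2) by (auto dest!: subsetD)
    then have "emeasure lborel X \<le> emeasure lborel {0..b}"
      by (intro emeasure_mono) auto
    then show ?thesis
      using b by (auto simp: top_unique)
  qed
  have seg': "measure lborel (S \<inter> {0..<a}) = \<theta> * a" if "0 \<le> a" "a \<le> b" for a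
    using seg[of a] that by (cases "a = 0") auto
  have S_eq: "S = S \<inter> {0..<b}"
    using S(2) by auto
  have "measure lborel (S \<inter> {x<..}) = \<theta> * (b - min b (max 0 x))"
  proof (cases "0 \<le> x \<and> x \<le> b")
    case True
    have "S \<inter> {0..x} = (S \<inter> {0..<x}) \<union> (S \<inter> {x})"
      using S(2) True by (auto simp: less_le)
    moreover have "S \<inter> {x} \<in> null_sets lborel"
      by (intro countable_imp_null_set_lborel) auto
    ultimately have "measure lborel (S \<inter> {0..x}) = measure lborel (S \<inter> {0..<x})"
      using S(1) by (simp add: measure_Un_null_set)
    then have "measure lborel (S \<inter> {0..x}) = \<theta> * x"
      using seg' True by simp
    moreover have "measure lborel S = measure lborel (S \<inter> {0..x}) + measure lborel (S \<inter> {x<..})"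
    proof -
      have "S = (S \<inter> {0..x}) \<union> (S \<inter> {x<..})" "(S \<inter> {0..x}) \<inter> (S \<inter> {x<..}) = {}"
        using S(2) by auto
      then show ?thesis
        using measure_Union[OF finite finite, of "S \<inter> {0..x}" "S \<inter> {x<..}"] S(1) by auto
    qed
    moreover have "measure lborel S = \<theta> * b"
      using seg'[of b] b S_eq by simp
    ultimately show ?thesis
      using True by (simp add: algebra_simps)
  next
    case False
    then consider "x < 0" | "b < x"
      by linarith
    then show ?thesis
    proof cases
      case 1
      then have "S \<inter> {x<..} = S \<inter> {0..<b}"
        using S(2) by auto
      then show ?thesis
        using seg'[of b] 1 b by simp
    next
      case 2
      then have "S \<inter> {x<..} = {}"
        using S(2) by auto
      then show ?thesis
        using 2 b by simp
    qed
  qed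
  then show ?thesis
    using finite[of "S \<inter> {x<..}"] by (simp add: emeasure_eq_ennreal_measure)
qed


text \<open>Lebesgue measure restricted to \<open>S\<close> and \<open>\<theta>\<close> times Lebesgue measure on \<open>[0, b)\<close> agree on
half-lines, hence on all Borel sets. Evaluated at \<open>S\<close> itself this reads \<open>m S = \<theta> * m S\<close>.\<close>

lemma borel_proportional_imp_zero_one:
  fixes b \<theta> :: real
  assumes S: "S \<in> sets borel" "S \<subseteq> {0..<b}" and b: "0 < b"
    and seg: "\<And>a. 0 < a \<Longrightarrow> a \<le> b \<Longrightarrow> measure lborel (S \<inter> {0..<a}) = \<theta> * a"
  shows "\<theta> = 0 \<or> \<theta> = 1"
proof -
  have "0 \<le> \<theta> * b"
    using seg[of b] b measure_nonneg[of lborel "S \<inter> {0..<b}"] by simp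
  then have \<theta>: "0 \<le> \<theta>"
    using b by (simp add: zero_le_mult_iff)
  define M where "M = density lborel (indicator S)"
  define N where "N = density (density lborel (indicator {0..<b})) (\<lambda>_. ennreal \<theta>)"
  have M: "emeasure M E = emeasure lborel (S \<inter> E)" if "E \<in> sets borel" for E
    unfolding M_def using that S(1) by (simp add: emeasure_restricted)
  have N: "emeasure N E = ennreal \<theta> * emeasure lborel ({0..<b} \<inter> E)" if "E \<in> sets borel" for E
    unfolding N_def using that by (simp add: emeasure_density_const emeasure_restricted)
  have "M = N"
  proof (rule measure_eqI_lessThan)
    fix x :: real
    have 1: "emeasure M {x<..} = ennreal (\<theta> * (b - min b (max 0 x)))"
      using borel_tail_measure_of_proportional[OF assms] M by simp
    then show "emeasure M {x<..} < \<infinity>"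
      by simp
    \<comment> \<open>The segment \<open>[0, b)\<close> is itself proportional, with \<open>\<theta> = 1\<close>.\<close>
    have "{0..<b} \<inter> {0..<a} = {0..<a}" if "a \<le> b" for a
      using that by auto
    then have "emeasure N {x<..} = ennreal \<theta> * ennreal (1 * (b - min b (max 0 x)))"
      using borel_tail_measure_of_proportional[of "{0..<b}" b 1 x] b N by simp
    then show "emeasure M {x<..} = emeasure N {x<..}"
      using 1 \<theta> by (simp add: ennreal_mult')
  qed (simp_all add: M_def N_def)
  then have "emeasure lborel S = ennreal \<theta> * emeasure lborel S"
    using M[OF S(1)] N[OF S(1)] S(2) by (simp add: Int_absorb1)
  then have "enn2real (emeasure lborel S) = enn2real (ennreal \<theta> * emeasure lborel S)"
    by (rule arg_cong)
  then have "measure lborel S = \<theta> * measure lborel S"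
    using \<theta> unfolding measure_def enn2real_mult by simp
  moreover have "measure lborel S = \<theta> * b"
    using seg[of b] b S(2) by (simp add: Int_absorb2)
  ultimately show ?thesis
    using b by simp
qed

text \<open>A Lebesgue measurable set differs from a Borel set by a null set, which does not affect the
hypothesis; this reduces the claim to the Borel case.\<close>

lemma lebesgue_proportional_imp_zero_one:
  fixes b \<theta> :: real
  assumes B: "B \<in> sets lebesgue" "B \<subseteq> {0..b}" and b: "0 < b"
    and seg: "\<And>a. 0 < a \<Longrightarrow> a \<le> b \<Longrightarrow> measure lebesgue (B \<inter> {0..<a}) = \<theta> * a"
  shows "B \<in> null_sets lebesgue \<or> {0..b} - B \<in> null_sets lebesgue"
proof -
  have "B \<inter> {0..<b} \<in> sets lebesgue"
    using B(1) by auto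
  then obtain S N N' where S: "B \<inter> {0..<b} = S \<union> N" "S \<in> sets borel"
    and N: "N \<subseteq> N'" "N' \<in> null_sets lborel"
    by (rule sets_completionE) auto
  have S_seg: "measure lborel (S \<inter> {0..<a}) = \<theta> * a" if "0 < a" "a \<le> b" for a
  proof -
    have null: "N \<inter> {0..<a} \<in> null_sets lebesgue"
      using N by (auto simp: null_sets_completion_iff2)
    have "B \<inter> {0..<a} = (B \<inter> {0..<b}) \<inter> {0..<a}"
      using that by auto
    then have "B \<inter> {0..<a} = S \<inter> {0..<a} \<union> N \<inter> {0..<a}"
      using S(1) by auto
    then have "measure lebesgue (S \<inter> {0..<a}) = \<theta> * a"
      using seg[OF that] null S(2) by (simp add: measure_Un_null_set)
    then show ?thesis
      using S(2) by simp
  qed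
  have "\<theta> = 0 \<or> \<theta> = 1"
    by (rule borel_proportional_imp_zero_one[OF S(2) _ b S_seg]) (use S(1) in auto)
  moreover have b_null: "{b} \<in> null_sets lebesgue"
    by (intro null_sets_completionI countable_imp_null_set_lborel) auto
  have B_diff_null: "B - {0..<b} \<in> null_sets lebesgue"
    using B by (intro null_sets_subset[OF b_null]) (auto simp: less_le)
  have finite: "X \<in> lmeasurable" if "X \<in> sets lebesgue" "X \<subseteq> {0..b}" for X
    using that by (auto intro: fmeasurableI2[of "{0..b}"])
  have whole: "measure lebesgue (B \<inter> {0..<b}) = \<theta> * b"
    using seg[of b] b by simp
  have null_if: "X \<in> null_sets lebesgue"
    if "X \<in> sets lebesgue" "X \<subseteq> {0..b}" "measure lebesgue X = 0" for X
    using finite[OF that(1,2)] that(3) negligible_iff_measure0 negligible_iff_null_sets by blast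
  ultimately show ?thesis
  proof (elim disjE)
    assume "\<theta> = 0"
    then have "B \<inter> {0..<b} \<in> null_sets lebesgue"
      using whole B by (intro null_if) auto
    then have "B \<inter> {0..<b} \<union> (B - {0..<b}) \<in> null_sets lebesgue"
      using B_diff_null by (rule null_sets.Un)
    then show ?thesis
      by (simp add: Int_Diff_Un)
  next
    assume "\<theta> = 1"
    have "measure lebesgue ({0..<b} - B \<inter> {0..<b}) = measure lebesgue {0..<b} - measure lebesgue (B \<inter> {0..<b})"
      using B b by (intro measurable_measure_Diff finite) auto
    moreover have "{0..<b} - B \<inter> {0..<b} \<in> sets lebesgue"
      using B(1) by (intro sets.Diff sets.Int) auto
    ultimately have "{0..<b} - B \<inter> {0..<b} \<in> null_sets lebesgue"
      using whole b \<open>\<theta> = 1\<close> by (intro null_if) auto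
    then have "({0..<b} - B \<inter> {0..<b}) \<union> {b} \<in> null_sets lebesgue"
      using b_null by (rule null_sets.Un)
    moreover have "{0..b} - B \<in> sets lebesgue"
      using B(1) by (intro sets.Diff) auto
    ultimately have "{0..b} - B \<in> null_sets lebesgue"
      by (rule null_sets_subset) (auto simp: less_le)
    then show ?thesis ..
  qed
qed

section \<open>Space-time harmonic functions of the endpoint chain\<close>

locale greedy_expansion =
  fixes q0 q1 :: real
  assumes q0_gt_1: "1 < q0" and q1_gt_1: "1 < q1" and q_le: "q0 * q1 \<le> q0 + q1"
begin

abbreviation b :: real where "b \<equiv> 1 / (q1 - 1)"
abbreviation r :: real where "r \<equiv> q0 / q1"

lemma breakpoint_less_r: "1 / q1 < r"
  using q0_gt_1 q1_gt_1 by (simp add: divide_strict_right_mono)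

lemma r_le_b: "r \<le> b"
  using q_le q1_gt_1 by (simp add: field_simps)

lemma breakpoint_pos: "0 < 1 / q1"
  using q1_gt_1 by simp

lemma r_pos: "0 < r"
  using q0_gt_1 q1_gt_1 by simp

text \<open>Harmonic functions of time \<open>n\<close> and state \<open>a\<close> for the endpoint chain: from \<open>a \<le> 1 / q1\<close> it moves to
\<open>q0 * a\<close>; from \<open>a > 1 / q1\<close> it jumps to \<open>r\<close> with probability \<open>1 / (q1 * a)\<close>, and otherwise moves to
\<open>q1 * a - 1\<close>.\<close>

definition harmonic :: "(nat \<Rightarrow> real \<Rightarrow> real) \<Rightarrow> bool" where
  "harmonic \<phi> \<longleftrightarrow>
     (\<forall>n. \<forall>a\<in>{0<..1 / q1}. \<phi> n a = \<phi> (Suc n) (q0 * a)) \<and>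
     (\<forall>n. \<forall>a\<in>{1 / q1<..b}. \<phi> n a =
        1 / (q1 * a) * \<phi> (Suc n) r + (1 - 1 / (q1 * a)) * \<phi> (Suc n) (q1 * a - 1))"

lemma harmonic_small:
  "harmonic \<phi> \<Longrightarrow> 0 < a \<Longrightarrow> a \<le> 1 / q1 \<Longrightarrow> \<phi> n a = \<phi> (Suc n) (q0 * a)"
  by (simp add: harmonic_def)

lemma harmonic_large:
  "harmonic \<phi> \<Longrightarrow> 1 / q1 < a \<Longrightarrow> a \<le> b \<Longrightarrow>
     \<phi> n a = 1 / (q1 * a) * \<phi> (Suc n) r + (1 - 1 / (q1 * a)) * \<phi> (Suc n) (q1 * a - 1)"
  by (simp add: harmonic_def)

lemma harmonic_uminus: "harmonic \<phi> \<Longrightarrow> harmonic (\<lambda>n a. - \<phi> n a)"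
  unfolding harmonic_def by simp

lemma harmonic_time_difference:
  assumes \<phi>: "harmonic \<phi>"
  shows "harmonic (\<lambda>n a. \<phi> (Suc n) a - \<phi> n a)"
proof -
  have "\<phi> (Suc n) a - \<phi> n a =
      1 / (q1 * a) * (\<phi> (Suc (Suc n)) r - \<phi> (Suc n) r) +
      (1 - 1 / (q1 * a)) * (\<phi> (Suc (Suc n)) (q1 * a - 1) - \<phi> (Suc n) (q1 * a - 1))"
    if "1 / q1 < a" "a \<le> b" for n a
    unfolding harmonic_large[OF \<phi> that, of n] harmonic_large[OF \<phi> that, of "Suc n"]
    by (simp only: right_diff_distrib)
  then show ?thesis
    unfolding harmonic_def using harmonic_small[OF \<phi>] by auto
qed

lemma small_step_in: "0 < a \<Longrightarrow> a \<le> 1 / q1 \<Longrightarrow> q0 * a \<in> {0<..b}"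
  using mult_left_mono[of a "1 / q1" q0] r_le_b q0_gt_1 by auto

lemma large_step_in: "1 / q1 < a \<Longrightarrow> a \<le> b \<Longrightarrow> q1 * a - 1 \<in> {0<..b}"
proof -
  assume a: "1 / q1 < a" "a \<le> b"
  have "a * (q1 - 1) \<le> 1" "1 < a * q1"
    using a q1_gt_1 by (simp_all add: field_simps)
  then have "q1 * a - 1 \<le> a" "0 < q1 * a - 1"
    by (simp_all add: algebra_simps)
  then show ?thesis
    using a by auto
qed

text \<open>Any state \<open>a \<le> 1 / q1\<close> is multiplied by \<open>q0\<close> until it exceeds \<open>1 / q1\<close>, and from there the chain
jumps to \<open>r\<close> with probability at least \<open>p = 1 / (q1 * b)\<close>. So the supremum \<open>S\<close> of \<open>\<phi>\<close> satisfies
\<open>S \<le> p * s + (1 - p) * S\<close>, that is \<open>S \<le> s\<close>.\<close>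

lemma harmonic_le_of_renewal_le:
  assumes \<phi>: "harmonic \<phi>"
    and bounded: "\<And>n a. a \<in> {0<..b} \<Longrightarrow> \<phi> n a \<le> C"
    and renewal: "\<And>n. \<phi> n r \<le> s"
    and a: "a \<in> {0<..b}"
  shows "\<phi> n a \<le> s"
proof -
  define S where "S = (SUP (n, a)\<in>UNIV \<times> {0<..b}. \<phi> n a)"
  have le_S: "\<phi> n a \<le> S" if "a \<in> {0<..b}" for n a
  proof -
    have "bdd_above ((\<lambda>(n, a). \<phi> n a) ` (UNIV \<times> {0<..b}))"
      using bounded by (intro bdd_aboveI2[of _ _ C]) auto
    then show ?thesis
      unfolding S_def using cSUP_upper[of "(n, a)" "UNIV \<times> {0<..b}" "\<lambda>(n, a). \<phi> n a"] that
      by simp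
  qed
  have "S \<le> s"
  proof (rule ccontr)
    assume "\<not> S \<le> s"
    define p where "p = 1 / (q1 * b)"
    have p: "0 < p"
      using q1_gt_1 by (simp add: p_def)
    have step: "\<phi> n a \<le> p * s + (1 - p) * S" if a: "1 / q1 < a" "a \<le> b" for n a
    proof -
      define t where "t = 1 / (q1 * a)"
      have a_pos: "0 < a"
        using a(1) breakpoint_pos by linarith
      have "p \<le> t"
        unfolding t_def p_def using a a_pos q1_gt_1
        by (intro divide_left_mono mult_left_mono mult_pos_pos) auto
      moreover have "t \<le> 1"
        unfolding t_def using a a_pos q1_gt_1 by (simp add: field_simps)
      ultimately have t: "p \<le> t" "t \<le> 1"
        by auto
      have "\<phi> n a = t * \<phi> (Suc n) r + (1 - t) * \<phi> (Suc n) (q1 * a - 1)"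
        unfolding t_def using \<phi> a by (rule harmonic_large)
      also have "\<dots> \<le> t * s + (1 - t) * S"
        using t p renewal le_S[OF large_step_in[OF a]]
        by (intro add_mono mult_left_mono) auto
      also have "\<dots> \<le> p * s + (1 - p) * S"
        using mult_right_mono[OF t(1), of "S - s"] \<open>\<not> S \<le> s\<close> by (simp add: algebra_simps)
      finally show ?thesis .
    qed
    have reach: "\<phi> n a \<le> p * s + (1 - p) * S" if "a \<in> {0<..b}" "1 / q1 < q0 ^ k * a" for k n a
      using that
    proof (induction k arbitrary: a n)
      case 0
      then show ?case
        using step by simp
    next
      case (Suc k)
      show ?case
      proof (cases "1 / q1 < a")
        case True
        then show ?thesis
          using step Suc.prems by simp
      next
        case False
        then show ?thesis
          using Suc.IH[of "q0 * a" "Suc n"] Suc.prems small_step_in harmonic_small[OF \<phi>]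
          by (simp add: mult_ac)
      qed
    qed
    have "\<phi> n a \<le> p * s + (1 - p) * S" if a: "a \<in> {0<..b}" for n a
    proof -
      obtain k where "1 / q1 / a < q0 ^ k"
        using real_arch_pow[OF q0_gt_1] by blast
      then have "1 / q1 < q0 ^ k * a"
        using a by (subst (asm) pos_divide_less_eq) auto
      with a show ?thesis
        by (rule reach)
    qed
    then have "S \<le> p * s + (1 - p) * S"
      unfolding S_def using q1_gt_1 by (intro cSUP_least) auto
    then have "p * (S - s) \<le> 0"
      by (simp add: algebra_simps)
    then show False
      using p \<open>\<not> S \<le> s\<close> by (simp add: mult_le_0_iff)
  qed
  then show ?thesis
    using le_S[OF a, of n] by linarith
qed

text \<open>If the supremum \<open>s\<close> of \<open>\<phi> n r\<close> were positive, then a value within \<open>e\<close> of \<open>s\<close> at time \<open>n\<close> would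
force a value within \<open>q0 * e\<close> of \<open>s\<close> at time \<open>n + 1\<close>, because the chain stays at \<open>r\<close> with
probability \<open>1 / q0\<close>. With \<open>e\<close> small enough, \<open>\<phi>\<close> would be at least \<open>s / 2\<close> at \<open>r\<close> for any
prescribed number of steps, and its sums could not be bounded.\<close>

lemma harmonic_sums_bounded_imp_nonpos:
  assumes \<phi>: "harmonic \<phi>"
    and bounded: "\<And>n a. a \<in> {0<..b} \<Longrightarrow> \<phi> n a \<le> C"
    and sums: "\<And>n J. (\<Sum>j<J. \<phi> (n + j) r) \<le> K"
  shows "\<phi> n r \<le> 0"
proof -
  define s where "s = (SUP n. \<phi> n r)"
  have r_in: "r \<in> {0<..b}"
    using r_pos r_le_b by simp
  have bdd: "bdd_above (range (\<lambda>n. \<phi> n r))"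
    using bounded[OF r_in] by (intro bdd_aboveI2)
  have le_s: "\<phi> n r \<le> s" for n
    unfolding s_def using bdd by (rule cSUP_upper2[where x = n]) auto
  have le_s': "\<phi> n a \<le> s" if "a \<in> {0<..b}" for n a
    using \<phi> bounded le_s that by (rule harmonic_le_of_renewal_le)
  have "s \<le> 0"
  proof (rule ccontr)
    assume s: "\<not> s \<le> 0"
    obtain J :: nat where J: "2 * K / s < J"
      using reals_Archimedean2 by blast
    \<comment> \<open>After \<open>J\<close> steps the error \<open>q0 ^ J * e\<close> is still only \<open>s / 2\<close>.\<close>
    define e where "e = s / (2 * q0 ^ J)"
    have e: "0 < e"
      using s q0_gt_1 by (simp add: e_def)
    obtain n where n: "s - e < \<phi> n r"
      using less_cSUP_iff[OF _ bdd, of "s - e"] e by (auto simp: s_def)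
    have persist: "s - q0 ^ j * e \<le> \<phi> (n + j) r" for j
    proof (induction j)
      case 0
      show ?case
        using n by simp
    next
      case (Suc j)
      have "\<phi> (n + j) r = 1 / q0 * \<phi> (n + Suc j) r + (1 - 1 / q0) * \<phi> (n + Suc j) (q1 * r - 1)"
        using harmonic_large[OF \<phi> breakpoint_less_r r_le_b, of "n + j"] q1_gt_1 by simp
      also have "\<dots> \<le> 1 / q0 * \<phi> (n + Suc j) r + (1 - 1 / q0) * s"
        using le_s'[OF large_step_in[OF breakpoint_less_r r_le_b]] q0_gt_1
        by (intro add_mono mult_left_mono) auto
      finally have "s - q0 ^ j * e \<le> 1 / q0 * \<phi> (n + Suc j) r + (1 - 1 / q0) * s"
        using Suc by linarith
      then have "q0 * (s - q0 ^ j * e) \<le> q0 * (1 / q0 * \<phi> (n + Suc j) r + (1 - 1 / q0) * s)"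
        using q0_gt_1 by (intro mult_left_mono) auto
      also have "\<dots> = \<phi> (n + Suc j) r + (q0 - 1) * s"
        using q0_gt_1 by (simp add: field_simps)
      finally show ?case
        by (simp add: algebra_simps)
    qed
    have "s / 2 \<le> \<phi> (n + j) r" if "j < J" for j
    proof -
      have "q0 ^ j * e \<le> q0 ^ J * e"
        using that q0_gt_1 e by (intro mult_right_mono power_increasing) auto
      then show ?thesis
        using persist[of j] q0_gt_1 by (simp add: e_def)
    qed
    then have "J * (s / 2) \<le> (\<Sum>j<J. \<phi> (n + j) r)"
      using sum_mono[of "{..<J}" "\<lambda>_. s / 2" "\<lambda>j. \<phi> (n + j) r"] by simp
    then have "J * s \<le> 2 * K"
      using sums[of n J] by linarith
    then show False
      using J s by (simp add: field_simps)
  qed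
  then show ?thesis
    using le_s[of n] by linarith
qed

text \<open>The time difference of \<open>\<phi>\<close> is harmonic and its sums over time telescope to bounded quantities, so
neither it nor its negative can be positive at \<open>r\<close>. Hence \<open>\<phi> n r\<close> is the same for all \<open>n\<close>, and this
common value bounds \<open>\<phi>\<close> from both sides.\<close>

lemma harmonic_constant:
  assumes \<phi>: "harmonic \<phi>"
    and bounded: "\<And>n a. a \<in> {0<..b} \<Longrightarrow> \<phi> n a \<in> {0..1}"
    and a: "a \<in> {0<..b}"
  shows "\<phi> n a = \<phi> 0 r"
proof -
  define d where "d n a = \<phi> (Suc n) a - \<phi> n a" for n a
  have r_in: "r \<in> {0<..b}"
    using r_pos r_le_b by simp
  have d: "harmonic d"
    unfolding d_def[abs_def] using \<phi> by (rule harmonic_time_difference)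
  have sum_d: "(\<Sum>j<J. d (n + j) r) = \<phi> (n + J) r - \<phi> n r" for n J
    unfolding d_def using sum_lessThan_telescope[of "\<lambda>j. \<phi> (n + j) r" J] by simp
  have d_bounded: "d n a \<le> 1" "- d n a \<le> 1" if "a \<in> {0<..b}" for n a
    using bounded[OF that, of n] bounded[OF that, of "Suc n"] by (auto simp: d_def)
  have "d n r \<le> 0" for n
    by (rule harmonic_sums_bounded_imp_nonpos[OF d d_bounded(1), where K = 1])
      (use bounded[OF r_in] in \<open>auto simp: sum_d diff_le_eq intro: add_increasing2 order_trans\<close>)
  moreover have "- d n r \<le> 0" for n
    by (rule harmonic_sums_bounded_imp_nonpos[OF harmonic_uminus[OF d] d_bounded(2), where K = 1])
      (use bounded[OF r_in] in \<open>auto simp: sum_negf sum_d diff_le_eq intro: add_increasing2 order_trans\<close>)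
  ultimately have step: "\<phi> (Suc n) r = \<phi> n r" for n
    by (auto simp: d_def intro: order_antisym)
  have r_const: "\<phi> n r = \<phi> 0 r" for n
    by (induction n) (simp_all add: step)
  have "\<phi> n a \<le> \<phi> 0 r"
    using harmonic_le_of_renewal_le[OF \<phi> _ eq_refl[OF r_const] a, of 1] bounded by simp
  moreover have "- \<phi> n a \<le> - \<phi> 0 r"
    using harmonic_le_of_renewal_le[OF harmonic_uminus[OF \<phi>] _ _ a, of 0 "- \<phi> 0 r"]
      bounded eq_refl[OF r_const[symmetric]] by simp
  ultimately show ?thesis
    by simp
qed

end

section \<open>Exactness of the greedy map for Lebesgue measure\<close>

definition seg_measure :: "real set \<Rightarrow> real \<Rightarrow> real" where
  "seg_measure A a = measure lebesgue (A \<inter> {0..<a})"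

lemma lmeasurable_seg: "A \<in> sets lebesgue \<Longrightarrow> A \<inter> {0..<a::real} \<in> lmeasurable"
  by (rule fmeasurableI2[of "{0..a}"]) auto

lemma seg_measure_nonneg: "0 \<le> seg_measure A a"
  by (simp add: seg_measure_def)

lemma seg_measure_le: "A \<in> sets lebesgue \<Longrightarrow> 0 \<le> a \<Longrightarrow> seg_measure A a \<le> a"
proof -
  assume "A \<in> sets lebesgue" "0 \<le> a"
  have "measure lebesgue (A \<inter> {0..<a}) \<le> measure lebesgue {0..<a}"
    using \<open>A \<in> sets lebesgue\<close> lmeasurable_seg[of UNIV a]
    by (intro measure_mono_fmeasurable fmeasurableD[OF lmeasurable_seg]) auto
  then show ?thesis
    using \<open>0 \<le> a\<close> by (simp add: seg_measure_def)
qed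

context greedy_expansion
begin

abbreviation G :: "real \<Rightarrow> real" where "G \<equiv> greedy_map q0 q1"
abbreviation L :: "real measure" where "L \<equiv> lebesgue_on (I_Q q1)"

lemma space_L: "space L = {0..b}"
  by (simp add: I_Q_def)

lemma G_in: "x \<in> I_Q q1 \<Longrightarrow> G x \<in> I_Q q1"
  using q0_gt_1 q1_gt_1 q_le by (rule greedy_map_in_I_Q)

lemma G_measurable: "G \<in> L \<rightarrow>\<^sub>M L"
proof (rule measurableI)
  show "G x \<in> space L" if "x \<in> space L" for x
    using that G_in by simp
  fix A assume "A \<in> sets L"
  then have A: "A \<in> sets lebesgue"
    by (simp add: sets_lebesgue_on_I_Q)
  have "G -` A \<inter> space L =
     ((\<lambda>x. q0 * x + 0) -` A \<inter> {..<1 / q1} \<union> (\<lambda>x. q1 * x + - 1) -` A \<inter> {1 / q1..}) \<inter> {0..b}"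
    by (auto simp: greedy_map_def I_Q_def split: if_splits)
  also have "\<dots> \<in> sets lebesgue"
    using A q0_gt_1 q1_gt_1 by (intro sets.Int sets.Un sets_lebesgue_affine_vimage) auto
  finally show "G -` A \<inter> space L \<in> sets L"
    unfolding sets_lebesgue_on_I_Q by simp
qed

text \<open>The second branch alone maps \<open>[1 / q1, b]\<close> onto \<open>[0, b]\<close>.\<close>

lemma G_surj: "G ` space L = space L"
proof (intro equalityI subsetI)
  show "y \<in> space L" if "y \<in> G ` space L" for y
    using that G_in by auto
  fix y assume y: "y \<in> space L"
  define x where "x = (y + 1) / q1"
  have "1 / q1 \<le> x" "x \<le> b" "0 \<le> x"
    using y q1_gt_1 by (auto simp: I_Q_def x_def field_simps)
  then have "G x = y" "x \<in> space L"
    using q1_gt_1 by (auto simp: greedy_map_def x_def I_Q_def)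
  then show "y \<in> G ` space L"
    by blast
qed

text \<open>This lemma and the next one express that \<open>G\<close> maps uniform distributions on \<open>[0, a)\<close> to mixtures of
such distributions, evaluated on a set \<open>A\<close>. For \<open>a \<le> 1 / q1\<close> only the first branch is met.\<close>

lemma seg_measure_G_small:
  assumes "A \<subseteq> I_Q q1" "a \<le> 1 / q1"
  shows "seg_measure (G -` A \<inter> space L) a = seg_measure A (q0 * a) / q0"
proof -
  have "a \<le> b"
    using assms(2) breakpoint_less_r r_le_b by linarith
  then have "(G -` A \<inter> space L) \<inter> {0..<a} = (\<lambda>x. q0 * x + 0) -` (A \<inter> {0..<q0 * a})"
    using assms q0_gt_1 by (auto simp: greedy_map_def I_Q_def zero_le_mult_iff split: if_splits)
  then show ?thesis
    using q0_gt_1 by (simp only: seg_measure_def measure_lebesgue_affine_vimage)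
qed

text \<open>The first branch maps \<open>[0, 1 / q1)\<close> onto \<open>[0, r)\<close> and the second one maps \<open>[1 / q1, a)\<close> onto
\<open>[0, q1 * a - 1)\<close>. The case \<open>a = 1 / q1\<close> is common to both lemmas.\<close>

lemma seg_measure_G_large:
  assumes A: "A \<subseteq> I_Q q1" "A \<in> sets lebesgue" and a: "1 / q1 \<le> a" "a \<le> b"
  shows "seg_measure (G -` A \<inter> space L) a = seg_measure A r / q0 + seg_measure A (q1 * a - 1) / q1"
proof -
  let ?X = "(\<lambda>x. q0 * x + 0) -` (A \<inter> {0..<r})"
  let ?Y = "(\<lambda>x. q1 * x + - 1) -` (A \<inter> {0..<q1 * a - 1})"
  have branch0: "q0 * x < q0 / q1 \<longleftrightarrow> x < 1 / q1" for x
    using q0_gt_1 q1_gt_1 by (simp add: field_simps)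
  have branch1: "0 \<le> q1 * x - 1 \<longleftrightarrow> 1 / q1 \<le> x" for x
    using q1_gt_1 by (simp add: field_simps)
  have "x \<in> (G -` A \<inter> space L) \<inter> {0..<a} \<longleftrightarrow> x \<in> ?X \<union> ?Y" for x
  proof (cases "x < 1 / q1")
    case True
    then show ?thesis
      using branch0[of x] branch1[of x] a q0_gt_1
      by (auto simp: greedy_map_def I_Q_def zero_le_mult_iff)
  next
    case False
    then show ?thesis
      using branch0[of x] branch1[of x] a q1_gt_1 order_trans[of 0 "1 / q1" x]
      by (auto simp: greedy_map_def I_Q_def)
  qed
  then have split: "(G -` A \<inter> space L) \<inter> {0..<a} = ?X \<union> ?Y"
    by blast
  have "?X \<in> lmeasurable" "?Y \<in> lmeasurable"
    using A(2) q0_gt_1 q1_gt_1 by (intro lmeasurable_affine_vimage lmeasurable_seg; simp)+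
  moreover have "?X \<inter> ?Y = {}"
    using branch0 branch1 by fastforce
  ultimately have "measure lebesgue (?X \<union> ?Y) = measure lebesgue ?X + measure lebesgue ?Y"
    by (auto simp: measure_Un3)
  then show ?thesis
    using q0_gt_1 q1_gt_1 by (simp only: seg_measure_def split measure_lebesgue_affine_vimage)
qed

text \<open>The proportions of the forward images of a tail set \<open>B\<close> in the segments \<open>[0, a)\<close> form a harmonic
function with values in \<open>[0, 1]\<close>, hence a constant, and the zero-one law applies to \<open>B\<close>.\<close>

lemma exact_lebesgue_G: "exact_system L G"
  unfolding exact_system_iff_tail_set
proof (intro allI impI)
  fix B assume B: "tail_set L G B"
  define A where "A n = (G ^^ n) ` B" for n
  define \<phi> where "\<phi> n a = seg_measure (A n) a / a" for n a
  have A: "A n \<subseteq> I_Q q1" "A n \<in> sets lebesgue" "A n = G -` A (Suc n) \<inter> space L" for n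
    using tail_set_forward_images[OF G_measurable G_surj B, of n]
    by (simp_all only: A_def sets_lebesgue_on_I_Q)
  have harmonic: "harmonic \<phi>"
    unfolding harmonic_def
  proof (intro conjI allI ballI)
    fix n a assume a: "a \<in> {0<..1 / q1}"
    then show "\<phi> n a = \<phi> (Suc n) (q0 * a)"
      using seg_measure_G_small[OF A(1), of a "Suc n"] A(3)[of n] by (simp add: \<phi>_def)
  next
    fix n a assume a: "a \<in> {1 / q1<..b}"
    then have pos: "0 < a" "0 < q1 * a - 1"
      using less_trans[OF breakpoint_pos] large_step_in[of a] by auto
    have "seg_measure (A n) a = seg_measure (A (Suc n)) r / q0 + seg_measure (A (Suc n)) (q1 * a - 1) / q1"
      using seg_measure_G_large[OF A(1,2), of a "Suc n"] A(3)[of n] a by simp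
    moreover have "1 - 1 / (q1 * a) = (q1 * a - 1) / (q1 * a)"
      using pos q1_gt_1 by (simp add: field_simps)
    ultimately show "\<phi> n a = 1 / (q1 * a) * \<phi> (Suc n) r + (1 - 1 / (q1 * a)) * \<phi> (Suc n) (q1 * a - 1)"
      using pos q0_gt_1 q1_gt_1 by (simp add: \<phi>_def add_divide_distrib mult_ac)
  qed
  have range: "\<phi> n a \<in> {0..1}" if "a \<in> {0<..b}" for n a
    using that seg_measure_nonneg[of "A n" a] seg_measure_le[OF A(2), of a n]
    by (simp add: \<phi>_def divide_le_eq_1)
  have "A 0 = B"
    by (simp add: A_def)
  have "measure lebesgue (B \<inter> {0..<a}) = \<phi> 0 r * a" if "0 < a" "a \<le> b" for a
    using harmonic_constant[OF harmonic range, of a 0] that \<open>A 0 = B\<close>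
    by (simp add: \<phi>_def[of 0 a] seg_measure_def field_simps)
  then have "B \<in> null_sets lebesgue \<or> {0..b} - B \<in> null_sets lebesgue"
    using A(1,2)[of 0] \<open>A 0 = B\<close> q1_gt_1
    by (intro lebesgue_proportional_imp_zero_one) (auto simp: I_Q_def)
  then show "B \<in> null_sets L \<or> space L - B \<in> null_sets L"
    using A(1)[of 0] \<open>A 0 = B\<close> unfolding null_sets_lebesgue_on_I_Q space_L
    by (auto simp: I_Q_def)
qed

end

section \<open>The invariant density of the greedy map\<close>

context greedy_expansion
begin

text \<open>The path of the endpoint chain from \<open>r\<close> that never jumps back to \<open>r\<close>. It follows the orbit of \<open>r\<close>
under \<open>G\<close>, except that the breakpoint \<open>1 / q1\<close> belongs to the first branch: endpoints of half-open
intervals move with the limit of \<open>G\<close> from the left.\<close>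

primrec endpoint :: "nat \<Rightarrow> real" where
  "endpoint 0 = r"
| "endpoint (Suc n) = (if endpoint n \<le> 1 / q1 then q0 * endpoint n else q1 * endpoint n - 1)"

primrec weight :: "nat \<Rightarrow> real" where
  "weight 0 = 1"
| "weight (Suc n) = weight n / (if endpoint n \<le> 1 / q1 then q0 else q1)"

lemma endpoint_in: "endpoint n \<in> {0<..b}"
proof (induction n)
  case 0
  show ?case
    using r_pos r_le_b by simp
next
  case (Suc n)
  then show ?case
    using small_step_in[of "endpoint n"] large_step_in[of "endpoint n"] by simp
qed

lemma weight_pos: "0 < weight n"
  using q0_gt_1 q1_gt_1 by (induction n) auto

lemma weight_le: "weight n \<le> (1 / min q0 q1) ^ n"
proof (induction n)
  case (Suc n)
  have "weight (Suc n) \<le> weight n / min q0 q1"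
    using weight_pos[of n] q0_gt_1 q1_gt_1 by (auto intro!: divide_left_mono)
  also have "\<dots> \<le> (1 / min q0 q1) ^ n / min q0 q1"
    using Suc q0_gt_1 q1_gt_1 by (intro divide_right_mono) auto
  finally show ?case
    by simp
qed simp

lemma summable_weight: "summable weight"
proof (rule summable_comparison_test')
  show "summable (\<lambda>n. (1 / min q0 q1) ^ n)"
    using q0_gt_1 q1_gt_1 by (intro summable_geometric) (simp add: min_def)
  show "norm (weight n) \<le> (1 / min q0 q1) ^ n" for n
    using weight_le[of n] weight_pos[of n] by simp
qed

definition raw_density :: "real \<Rightarrow> real" where
  "raw_density x = (\<Sum>n. weight n * indicator {..<endpoint n} x)"

text \<open>The integral of \<open>raw_density\<close> over \<open>A\<close>, computed term by term.\<close>

definition mass :: "real set \<Rightarrow> real" where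
  "mass A = (\<Sum>n. weight n * seg_measure A (endpoint n))"

lemma summable_raw_density: "summable (\<lambda>n. weight n * indicator {..<endpoint n} x)"
  using less_imp_le[OF weight_pos]
  by (intro summable_comparison_test'[OF summable_weight, of 0]) (auto simp: indicator_def)

lemma raw_density_nonneg: "0 \<le> raw_density x"
  unfolding raw_density_def using summable_raw_density less_imp_le[OF weight_pos]
  by (intro suminf_nonneg) auto

lemma raw_density_le: "raw_density x \<le> suminf weight"
  unfolding raw_density_def using less_imp_le[OF weight_pos]
  by (intro suminf_le summable_raw_density summable_weight) (auto simp: indicator_def)

lemma raw_density_antimono: "x \<le> y \<Longrightarrow> raw_density y \<le> raw_density x"
  unfolding raw_density_def using less_imp_le[OF weight_pos]
  by (intro suminf_le summable_raw_density) (auto simp: indicator_def)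

lemma raw_density_measurable: "raw_density \<in> borel_measurable L"
proof -
  have "raw_density \<in> borel_measurable borel"
    unfolding raw_density_def by measurable
  then show ?thesis
    by (intro measurable_restrict_space1 measurable_completion) simp
qed

lemma summable_mass:
  assumes A: "A \<in> sets lebesgue"
  shows "summable (\<lambda>n. weight n * seg_measure A (endpoint n))"
proof (rule summable_comparison_test')
  show "summable (\<lambda>n. weight n * b)"
    using summable_weight by (rule summable_mult2)
  fix n
  have "norm (weight n * seg_measure A (endpoint n)) = weight n * seg_measure A (endpoint n)"
    using weight_pos[of n] seg_measure_nonneg by simp
  also have "\<dots> \<le> weight n * b"
    using weight_pos[of n] endpoint_in[of n] seg_measure_le[OF A, of "endpoint n"]
    by (intro mult_left_mono) auto
  finally show "norm (weight n * seg_measure A (endpoint n)) \<le> weight n * b" .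
qed

lemma seg_measure_space_r: "seg_measure (space L) r = r"
proof -
  have "space L \<inter> {0..<r} = {0..<r}"
    using r_le_b by (auto simp: I_Q_def)
  then show ?thesis
    using r_pos by (simp add: seg_measure_def)
qed

lemma space_L_lebesgue: "space L \<in> sets lebesgue"
  by (simp add: I_Q_def)

lemma mass_space_pos: "0 < mass (space L)"
proof -
  have "(\<Sum>n<1. weight n * seg_measure (space L) (endpoint n)) \<le> mass (space L)"
    unfolding mass_def using space_L_lebesgue seg_measure_nonneg less_imp_le[OF weight_pos]
    by (intro sum_le_suminf summable_mass) auto
  then show ?thesis
    using r_pos seg_measure_space_r by simp
qed

text \<open>Pushing the \<open>n\<close>-th term of the density forward yields the term with index \<open>Suc n\<close> plus \<open>c n\<close> times
the indicator of \<open>[0, r)\<close>, which is the \<open>0\<close>-th term. The sum is reproduced exactly if \<open>c\<close> sums to \<open>1\<close>,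
and the case where \<open>A\<close> is the whole interval shows that it does.\<close>

lemma mass_G_invariant:
  assumes A: "A \<in> sets L"
  shows "mass (G -` A \<inter> space L) = mass A"
proof -
  define c where "c n = (if endpoint n \<le> 1 / q1 then 0 else weight n / q0)" for n
  have "summable c"
  proof (rule summable_comparison_test'[OF summable_weight])
    show "norm (c n) \<le> weight n" for n
      using weight_pos[of n] q0_gt_1 by (simp add: c_def divide_le_eq)
  qed
  have balance: "mass (G -` X \<inter> space L) = mass X + (suminf c - 1) * seg_measure X r"
    if X: "X \<in> sets L" for X
  proof -
    have X': "X \<subseteq> I_Q q1" "X \<in> sets lebesgue"
      using X by (simp_all add: sets_lebesgue_on_I_Q)
    have "weight n * seg_measure (G -` X \<inter> space L) (endpoint n) =
        c n * seg_measure X r + weight (Suc n) * seg_measure X (endpoint (Suc n))" for n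
      using seg_measure_G_small[OF X'(1), of "endpoint n"]
        seg_measure_G_large[OF X', of "endpoint n"] endpoint_in[of n]
      by (simp add: c_def algebra_simps)
    then have "mass (G -` X \<inter> space L) =
        (\<Sum>n. c n * seg_measure X r + weight (Suc n) * seg_measure X (endpoint (Suc n)))"
      unfolding mass_def by (rule suminf_cong)
    also have "\<dots> = (\<Sum>n. c n * seg_measure X r) +
        (\<Sum>n. weight (Suc n) * seg_measure X (endpoint (Suc n)))"
      using \<open>summable c\<close> summable_mass[OF X'(2)]
      by (intro suminf_add[symmetric] summable_mult2)
        (simp_all add: summable_Suc_iff[of "\<lambda>n. weight n * seg_measure X (endpoint n)"] del: weight.simps endpoint.simps)
    also have "\<dots> = suminf c * seg_measure X r + (mass X - seg_measure X r)"
      using suminf_mult2[OF \<open>summable c\<close>, of "seg_measure X r"] suminf_split_head[OF summable_mass[OF X'(2)]]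
      by (simp add: mass_def del: weight.simps(2) endpoint.simps(2))
    finally show ?thesis
      by (simp add: algebra_simps)
  qed
  have "G -` space L \<inter> space L = space L"
    using measurable_space[OF G_measurable] by auto
  then have "suminf c = 1"
    using balance[of "space L"] seg_measure_space_r r_pos q0_gt_1 q1_gt_1 by simp
  then show ?thesis
    using balance[OF A] by simp
qed

lemma emeasure_raw_density:
  assumes A: "A \<in> sets L" and k: "0 \<le> k"
  shows "emeasure (density L (\<lambda>x. ennreal (k * raw_density x))) A = ennreal (k * mass A)"
proof -
  have A': "A \<subseteq> I_Q q1" "A \<in> sets lebesgue"
    using A by (simp_all add: sets_lebesgue_on_I_Q)
  let ?f = "\<lambda>n x. ennreal (k * weight n) * indicator (A \<inter> {0..<endpoint n}) x"
  have seg: "A \<inter> {0..<endpoint n} \<in> sets L" for n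
    using A' by (auto simp: sets_lebesgue_on_I_Q)
  have "emeasure (density L (\<lambda>x. ennreal (k * raw_density x))) A =
      (\<integral>\<^sup>+x. ennreal (k * raw_density x) * indicator A x \<partial>L)"
    using A raw_density_measurable by (intro emeasure_density) auto
  also have "\<dots> = (\<integral>\<^sup>+x. (\<Sum>n. ?f n x) \<partial>L)"
  proof (intro nn_integral_cong)
    fix x assume x: "x \<in> space L"
    have "ennreal (k * raw_density x) = (\<Sum>n. ennreal (k * (weight n * indicator {..<endpoint n} x)))"
      unfolding raw_density_def suminf_mult[OF summable_raw_density, symmetric]
      using k less_imp_le[OF weight_pos] summable_raw_density
      by (intro suminf_ennreal2[symmetric] summable_mult) auto
    then have "ennreal (k * raw_density x) * indicator A x =
        (\<Sum>n. ennreal (k * (weight n * indicator {..<endpoint n} x)) * indicator A x)"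
      by simp
    also have "\<dots> = (\<Sum>n. ?f n x)"
      using x by (intro suminf_cong) (auto simp: indicator_def I_Q_def)
    finally show "ennreal (k * raw_density x) * indicator A x = (\<Sum>n. ?f n x)" .
  qed
  also have "\<dots> = (\<Sum>n. \<integral>\<^sup>+x. ?f n x \<partial>L)"
    using seg by (intro nn_integral_suminf) auto
  also have "\<dots> = (\<Sum>n. ennreal (k * (weight n * seg_measure A (endpoint n))))"
  proof (intro suminf_cong)
    fix n
    have "emeasure L (A \<inter> {0..<endpoint n}) = emeasure lebesgue (A \<inter> {0..<endpoint n})"
      using A' by (intro emeasure_lebesgue_on_I_Q) auto
    also have "\<dots> = ennreal (seg_measure A (endpoint n))"
      using lmeasurable_seg[OF A'(2)] unfolding seg_measure_def
      by (rule emeasure_eq_measure2)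
    finally show "(\<integral>\<^sup>+x. ?f n x \<partial>L) = ennreal (k * (weight n * seg_measure A (endpoint n)))"
      using seg[of n] k weight_pos[of n] seg_measure_nonneg
      by (simp add: nn_integral_cmult_indicator ennreal_mult'' mult.assoc flip: mult.assoc)
  qed
  also have "\<dots> = ennreal (k * mass A)"
    unfolding mass_def suminf_mult[OF summable_mass[OF A'(2)], symmetric]
    using k less_imp_le[OF weight_pos] summable_mass[OF A'(2)] seg_measure_nonneg
    by (intro suminf_ennreal2 summable_mult) auto
  finally show ?thesis .
qed

lemma greedy_invariant_density:
  obtains \<mu> h where "invariant_prob_on (I_Q q1) G \<mu>" "is_density L \<mu> h"
    "bounded (h ` I_Q q1)" "antimono_on (I_Q q1) h"
proof
  define k where "k = 1 / mass (space L)"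
  define h where "h x = k * raw_density x" for x
  define \<mu> where "\<mu> = density L (\<lambda>x. ennreal (h x))"
  have k: "0 < k"
    using mass_space_pos by (simp add: k_def)
  have \<mu>: "emeasure \<mu> A = ennreal (k * mass A)" if "A \<in> sets L" for A
    unfolding \<mu>_def h_def using that k by (intro emeasure_raw_density) auto
  have [simp]: "sets \<mu> = sets L" "space \<mu> = space L"
    by (simp_all add: \<mu>_def)
  show "is_density L \<mu> h"
    unfolding is_density_def h_def \<mu>_def
    using k raw_density_nonneg raw_density_measurable by auto
  show "bounded (h ` I_Q q1)"
    using k raw_density_le raw_density_nonneg
    by (intro boundedI[of _ "k * suminf weight"]) (auto simp: h_def abs_mult intro!: mult_left_mono)
  show "antimono_on (I_Q q1) h"
    using k raw_density_antimono by (auto simp: monotone_on_def h_def)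
  have "prob_space \<mu>"
  proof
    show "emeasure \<mu> (space \<mu>) = 1"
      using \<mu>[of "space L"] mass_space_pos by (simp add: k_def)
  qed
  moreover have "invariant_under \<mu> G"
    unfolding invariant_under_def
  proof (intro conjI ballI)
    show "G \<in> \<mu> \<rightarrow>\<^sub>M \<mu>"
      using G_measurable by (simp add: \<mu>_def)
    fix E assume "E \<in> sets \<mu>"
    then have E: "E \<in> sets L"
      by simp
    show "emeasure \<mu> (G -` E \<inter> space \<mu>) = emeasure \<mu> E"
      using \<mu>[OF E] \<mu>[OF measurable_sets[OF G_measurable E]] mass_G_invariant[OF E] by simp
  qed
  ultimately show "invariant_prob_on (I_Q q1) G \<mu>"
    by (simp add: invariant_prob_on_def)
qed

end

section \<open>The lazy map\<close>

lemma greedy_map_measurable: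
  assumes "1 < q0" "1 < q1" "q0 * q1 \<le> q0 + q1"
  shows "greedy_map q0 q1 \<in> lebesgue_on (I_Q q1) \<rightarrow>\<^sub>M lebesgue_on (I_Q q1)"
proof -
  interpret greedy_expansion q0 q1
    by standard fact+
  show ?thesis
    by (rule G_measurable)
qed

text \<open>The decreasing affine bijection from the interval with right end \<open>1 / (q - 1)\<close> to the one with
right end \<open>1 / (p - 1)\<close>.\<close>

definition flip :: "real \<Rightarrow> real \<Rightarrow> real \<Rightarrow> real" where
  "flip p q x = (1 - (q - 1) * x) / (p - 1)"

lemma flip_flip: "1 < p \<Longrightarrow> 1 < q \<Longrightarrow> flip q p (flip p q x) = x"
  by (simp add: flip_def)

lemma flip_in_I_Q: "1 < p \<Longrightarrow> 1 < q \<Longrightarrow> x \<in> I_Q q \<Longrightarrow> flip p q x \<in> I_Q p"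
proof -
  assume pq: "1 < p" "1 < q" and x: "x \<in> I_Q q"
  have "(q - 1) * x \<le> 1"
    using pq x by (simp add: I_Q_def field_simps)
  moreover have "0 \<le> (q - 1) * x"
    using pq x by (simp add: I_Q_def)
  ultimately show ?thesis
    using pq by (simp add: flip_def I_Q_def divide_right_mono)
qed

lemma flip_eq_affine: "flip p q = (\<lambda>x. - ((q - 1) / (p - 1)) * x + 1 / (p - 1))"
  by (rule ext, cases "p = 1") (simp_all add: flip_def field_simps)

text \<open>The reflection exchanges the slopes, and it exchanges \<open>\<le>\<close> and \<open>\<ge>\<close>: the lazy map gives its
breakpoint to the left branch, as the greedy map gives its breakpoint to the right branch, so the
identity holds at the breakpoint too.\<close>

lemma lazy_map_eq_flip_greedy_map:
  assumes "1 < q0" "1 < q1"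
  shows "lazy_map q0 q1 x = flip q1 q0 (greedy_map q1 q0 (flip q0 q1 x))"
proof -
  have "flip q0 q1 x < 1 / q0 \<longleftrightarrow> \<not> x \<le> 1 / (q0 * (q1 - 1))"
    using assms by (simp add: flip_def field_simps not_le)
  then show ?thesis
    using assms by (auto simp: lazy_map_def greedy_map_def flip_def field_simps)
qed

lemma flip_measurable:
  assumes "1 < p" "1 < q"
  shows "flip p q \<in> lebesgue_on (I_Q q) \<rightarrow>\<^sub>M lebesgue_on (I_Q p)"
proof (rule measurableI)
  show "flip p q x \<in> space (lebesgue_on (I_Q p))" if "x \<in> space (lebesgue_on (I_Q q))" for x
    using that assms flip_in_I_Q by simp
  fix A assume "A \<in> sets (lebesgue_on (I_Q p))"
  then have "flip p q -` A \<in> sets lebesgue"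
    unfolding flip_eq_affine sets_lebesgue_on_I_Q
    using assms by (intro sets_lebesgue_affine_vimage) auto
  then have "flip p q -` A \<inter> I_Q q \<in> sets lebesgue"
    by (intro sets.Int) (auto simp: I_Q_def)
  then show "flip p q -` A \<inter> space (lebesgue_on (I_Q q)) \<in> sets (lebesgue_on (I_Q q))"
    unfolding sets_lebesgue_on_I_Q by simp
qed

lemma distr_lebesgue_flip:
  assumes p: "1 < p" and q: "1 < q"
  shows "distr (lebesgue_on (I_Q q)) (lebesgue_on (I_Q p)) (flip p q) =
    density (lebesgue_on (I_Q p)) (\<lambda>_. ennreal ((p - 1) / (q - 1)))"
proof (rule measure_eqI)
  fix A assume "A \<in> sets (distr (lebesgue_on (I_Q q)) (lebesgue_on (I_Q p)) (flip p q))"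
  then have A: "A \<in> sets (lebesgue_on (I_Q p))"
    by simp
  then have A': "A \<subseteq> I_Q p" "A \<in> sets lebesgue"
    by (simp_all add: sets_lebesgue_on_I_Q)
  have sub: "flip p q -` A \<subseteq> I_Q q"
  proof
    fix x assume "x \<in> flip p q -` A"
    then have "flip q p (flip p q x) \<in> I_Q q"
      using A'(1) by (intro flip_in_I_Q[OF q p]) auto
    then show "x \<in> I_Q q"
      by (simp only: flip_flip[OF p q])
  qed
  have "emeasure (distr (lebesgue_on (I_Q q)) (lebesgue_on (I_Q p)) (flip p q)) A =
      emeasure (lebesgue_on (I_Q q)) (flip p q -` A \<inter> I_Q q)"
    using emeasure_distr[OF flip_measurable[OF p q] A] by simp
  also have "\<dots> = emeasure lebesgue (flip p q -` A)"
    using sub by (simp only: Int_absorb2 emeasure_lebesgue_on_I_Q)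
  also have "\<dots> = ennreal (1 / \<bar>- ((q - 1) / (p - 1))\<bar>) * emeasure lebesgue A"
    unfolding flip_eq_affine using p q by (intro emeasure_lebesgue_affine_vimage) auto
  also have "1 / \<bar>- ((q - 1) / (p - 1))\<bar> = (p - 1) / (q - 1)"
    using p q by simp
  also have "emeasure lebesgue A = emeasure (lebesgue_on (I_Q p)) A"
    using A'(1) by (simp only: emeasure_lebesgue_on_I_Q)
  finally show "emeasure (distr (lebesgue_on (I_Q q)) (lebesgue_on (I_Q p)) (flip p q)) A =
      emeasure (density (lebesgue_on (I_Q p)) (\<lambda>_. ennreal ((p - 1) / (q - 1)))) A"
    using emeasure_density_const[OF A] by simp
qed simp

lemma lazy_map_measurable:
  assumes q: "1 < q0" "1 < q1" "q0 * q1 \<le> q0 + q1"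
  shows "lazy_map q0 q1 \<in> lebesgue_on (I_Q q1) \<rightarrow>\<^sub>M lebesgue_on (I_Q q1)"
proof -
  have "greedy_map q1 q0 \<in> lebesgue_on (I_Q q0) \<rightarrow>\<^sub>M lebesgue_on (I_Q q0)"
    using q by (intro greedy_map_measurable) (simp_all add: ac_simps)
  then have "flip q1 q0 \<circ> (greedy_map q1 q0 \<circ> flip q0 q1) \<in> lebesgue_on (I_Q q1) \<rightarrow>\<^sub>M lebesgue_on (I_Q q1)"
    using q by (intro measurable_comp[OF _ flip_measurable] measurable_comp[OF flip_measurable])
  moreover have "lazy_map q0 q1 = flip q1 q0 \<circ> (greedy_map q1 q0 \<circ> flip q0 q1)"
    using lazy_map_eq_flip_greedy_map[OF q(1,2)] by auto
  ultimately show ?thesis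
    by simp
qed

lemma lazy_map_flip:
  assumes "1 < q0" "1 < q1"
  shows "lazy_map q0 q1 (flip q1 q0 y) = flip q1 q0 (greedy_map q1 q0 y)"
  using assms by (simp add: lazy_map_eq_flip_greedy_map flip_flip)

text \<open>The reflection sends Lebesgue measure to a positive multiple of Lebesgue measure, which has the
same null sets, so exactness of the greedy map for the exchanged pair carries over.\<close>

lemma exact_lebesgue_lazy:
  assumes q: "1 < q0" "1 < q1" "q0 * q1 \<le> q0 + q1"
  shows "exact_system (lebesgue_on (I_Q q1)) (lazy_map q0 q1)"
proof -
  interpret greedy_expansion q1 q0
    using q by unfold_locales (simp_all add: ac_simps)
  let ?D = "density (lebesgue_on (I_Q q1)) (\<lambda>_. ennreal ((q1 - 1) / (q0 - 1)))"
  have "exact_system (distr (lebesgue_on (I_Q q0)) (lebesgue_on (I_Q q1)) (flip q1 q0)) (lazy_map q0 q1)"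
    using flip_measurable[OF q(2,1)] lazy_map_measurable[OF q] G_measurable lazy_map_flip[OF q(1,2)]
      exact_lebesgue_G by (rule exact_system_factor)
  then have "exact_system ?D (lazy_map q0 q1)"
    by (simp only: distr_lebesgue_flip[OF q(2,1)])
  moreover have "absolutely_continuous ?D (lebesgue_on (I_Q q1))"
    unfolding absolutely_continuous_def
  proof
    fix A assume "A \<in> null_sets ?D"
    then have "A \<in> sets (lebesgue_on (I_Q q1))" "AE x in lebesgue_on (I_Q q1). x \<notin> A"
      using q by (simp_all add: null_sets_density_iff ennreal_eq_0_iff divide_le_0_iff)
    then show "A \<in> null_sets (lebesgue_on (I_Q q1))"
      by (simp only: AE_iff_null_sets)
  qed
  ultimately show ?thesis
    by (rule exact_system_absolutely_continuous) simp
qed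

text \<open>The image under the reflection of the invariant measure of the greedy map for the exchanged pair;
the factor \<open>(q1 - 1) / (q0 - 1)\<close> in its density is the Jacobian of the reflection.\<close>

lemma lazy_invariant_density:
  assumes q: "1 < q0" "1 < q1" "q0 * q1 \<le> q0 + q1"
  obtains \<mu> h where "invariant_prob_on (I_Q q1) (lazy_map q0 q1) \<mu>"
    "is_density (lebesgue_on (I_Q q1)) \<mu> h" "bounded (h ` I_Q q1)" "mono_on (I_Q q1) h"
proof -
  interpret greedy_expansion q1 q0
    using q by unfold_locales (simp_all add: ac_simps)
  let ?J = "lebesgue_on (I_Q q0)" and ?I = "lebesgue_on (I_Q q1)"
  obtain \<nu> g where \<nu>: "invariant_prob_on (I_Q q0) (greedy_map q1 q0) \<nu>" and g: "is_density ?J \<nu> g"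
    and g_bounded: "bounded (g ` I_Q q0)" and g_antimono: "antimono_on (I_Q q0) g"
    by (rule greedy_invariant_density)
  have sets_\<nu>: "sets \<nu> = sets ?J"
    using \<nu> by (simp add: invariant_prob_on_def)
  have to_I: "flip q1 q0 \<in> \<nu> \<rightarrow>\<^sub>M ?I"
    using flip_measurable[OF q(2,1)] by (simp only: measurable_cong_sets[OF sets_\<nu> refl])
  have to_J: "flip q0 q1 \<in> ?I \<rightarrow>\<^sub>M ?J"
    using q by (intro flip_measurable)
  have g': "g \<in> borel_measurable ?J" "\<And>y. y \<in> I_Q q0 \<Longrightarrow> 0 \<le> g y" "\<nu> = density ?J (\<lambda>y. ennreal (g y))"
    using g by (simp_all add: is_density_def)
  define k where "k = (q1 - 1) / (q0 - 1)"
  have k: "0 < k"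
    using q by (simp add: k_def)
  define h where "h x = k * g (flip q0 q1 x)" for x
  define \<mu> where "\<mu> = distr \<nu> ?I (flip q1 q0)"
  show thesis
  proof
    show "invariant_prob_on (I_Q q1) (lazy_map q0 q1) \<mu>"
      unfolding invariant_prob_on_def
    proof (intro conjI)
      show "sets \<mu> = sets ?I"
        by (simp add: \<mu>_def)
      show "prob_space \<mu>"
        unfolding \<mu>_def using \<nu> to_I by (intro prob_space.prob_space_distr) (auto simp: invariant_prob_on_def)
      show "invariant_under \<mu> (lazy_map q0 q1)"
        unfolding \<mu>_def using \<nu> lazy_map_flip[OF q(1,2)] lazy_map_measurable[OF q] to_I
        by (intro invariant_under_factor) (auto simp: invariant_prob_on_def)
    qed
    have g_flip: "(\<lambda>x. ennreal (g (flip q0 q1 x))) \<in> borel_measurable ?I"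
      using measurable_compose[OF to_J g'(1)] by simp
    have "\<mu> = distr (density ?J (\<lambda>y. ennreal (g (flip q0 q1 (flip q1 q0 y))))) ?I (flip q1 q0)"
      unfolding \<mu>_def g'(3) using q by (simp add: flip_flip)
    also have "\<dots> = density (distr ?J ?I (flip q1 q0)) (\<lambda>x. ennreal (g (flip q0 q1 x)))"
      using g_flip flip_measurable[OF q(2,1)] by (rule density_distr[symmetric])
    also have "\<dots> = density (density ?I (\<lambda>_. ennreal k)) (\<lambda>x. ennreal (g (flip q0 q1 x)))"
      unfolding k_def by (simp only: distr_lebesgue_flip[OF q(2,1)])
    also have "\<dots> = density ?I (\<lambda>x. ennreal k * ennreal (g (flip q0 q1 x)))"
      using g_flip by (intro density_density_eq) auto
    also have "\<dots> = density ?I (\<lambda>x. ennreal (h x))"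
      using k by (simp add: h_def ennreal_mult')
    finally have "\<mu> = density ?I (\<lambda>x. ennreal (h x))" .
    moreover have "h \<in> borel_measurable ?I"
      unfolding h_def using measurable_compose[OF to_J g'(1)] by simp
    ultimately show "is_density ?I \<mu> h"
      unfolding is_density_def using g'(2) k flip_in_I_Q[OF q(1,2)] by (simp add: h_def)
    have "h ` I_Q q1 \<subseteq> (\<lambda>y. k *\<^sub>R y) ` (g ` I_Q q0)"
      using flip_in_I_Q[OF q(1,2)] by (auto simp: h_def)
    then show "bounded (h ` I_Q q1)"
      using bounded_scaling[OF g_bounded] by (rule bounded_subset[rotated])
    show "mono_on (I_Q q1) h"
    proof (rule mono_onI)
      fix x y assume xy: "x \<in> I_Q q1" "y \<in> I_Q q1" "x \<le> y"
      then have "flip q0 q1 y \<le> flip q0 q1 x"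
        unfolding flip_def using q by (intro divide_right_mono) auto
      then have "g (flip q0 q1 x) \<le> g (flip q0 q1 y)"
        using g_antimono flip_in_I_Q[OF q(1,2)] xy(1,2) by (auto simp: monotone_on_def)
      then show "h x \<le> h y"
        using k by (simp add: h_def)
    qed
  qed
qed

lemma is_density_imp_absolutely_continuous:
  assumes "is_density M N h"
  shows "absolutely_continuous M N"
  using assms by (auto simp: is_density_def intro!: absolutely_continuousI_density)

theorem theorem1p1:
  fixes q0 q1 :: real
  assumes "1 < q0" and "1 < q1" and "q0 + q1 \<ge> q0 * q1"
  shows "\<exists>\<mu>g \<mu>l :: real measure.
     (invariant_prob_on (I_Q q1) (greedy_map q0 q1) \<mu>g
      \<and> (\<forall>\<nu>. invariant_prob_on (I_Q q1) (greedy_map q0 q1) \<nu>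
              \<and> absolutely_continuous (lebesgue_on (I_Q q1)) \<nu> \<longrightarrow> \<nu> = \<mu>g)
      \<and> invariant_prob_on (I_Q q1) (lazy_map q0 q1) \<mu>l
      \<and> (\<forall>\<nu>. invariant_prob_on (I_Q q1) (lazy_map q0 q1) \<nu>
              \<and> absolutely_continuous (lebesgue_on (I_Q q1)) \<nu> \<longrightarrow> \<nu> = \<mu>l))
   \<and> (absolutely_continuous (lebesgue_on (I_Q q1)) \<mu>g
      \<and> absolutely_continuous (lebesgue_on (I_Q q1)) \<mu>l
      \<and> (\<exists>h. is_density (lebesgue_on (I_Q q1)) \<mu>g h \<and> bounded (h ` I_Q q1)
              \<and> antimono_on (I_Q q1) h)
      \<and> (\<exists>h. is_density (lebesgue_on (I_Q q1)) \<mu>l h \<and> bounded (h ` I_Q q1)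
              \<and> mono_on (I_Q q1) h))
   \<and> (exact_system \<mu>g (greedy_map q0 q1) \<and> exact_system \<mu>l (lazy_map q0 q1))"
proof -
  let ?L = "lebesgue_on (I_Q q1)"
  interpret greedy_expansion q0 q1
    using assms by unfold_locales auto
  obtain \<mu>g hg where g: "invariant_prob_on (I_Q q1) (greedy_map q0 q1) \<mu>g" "is_density ?L \<mu>g hg"
    "bounded (hg ` I_Q q1)" "antimono_on (I_Q q1) hg"
    by (rule greedy_invariant_density)
  obtain \<mu>l hl where l: "invariant_prob_on (I_Q q1) (lazy_map q0 q1) \<mu>l" "is_density ?L \<mu>l hl"
    "bounded (hl ` I_Q q1)" "mono_on (I_Q q1) hl"
    by (rule lazy_invariant_density[OF assms])
  have ac: "absolutely_continuous ?L \<mu>g" "absolutely_continuous ?L \<mu>l"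
    using g(2) l(2) by (auto intro: is_density_imp_absolutely_continuous)
  have exact_lazy: "exact_system ?L (lazy_map q0 q1)"
    using assms by (rule exact_lebesgue_lazy)
  have "\<forall>\<nu>. invariant_prob_on (I_Q q1) (greedy_map q0 q1) \<nu> \<and> absolutely_continuous ?L \<nu> \<longrightarrow> \<nu> = \<mu>g"
    using g(1) ac(1) exact_imp_unique_invariant_prob[OF exact_lebesgue_G G_measurable]
    by (simp add: invariant_prob_on_def)
  moreover have "\<forall>\<nu>. invariant_prob_on (I_Q q1) (lazy_map q0 q1) \<nu> \<and> absolutely_continuous ?L \<nu> \<longrightarrow> \<nu> = \<mu>l"
    using l(1) ac(2) exact_imp_unique_invariant_prob[OF exact_lazy lazy_map_measurable[OF assms]]
    by (simp add: invariant_prob_on_def)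
  moreover have "exact_system \<mu>g (greedy_map q0 q1)" "exact_system \<mu>l (lazy_map q0 q1)"
    using g(1) l(1) exact_system_absolutely_continuous[OF exact_lebesgue_G ac(1)]
      exact_system_absolutely_continuous[OF exact_lazy ac(2)]
    by (simp_all add: invariant_prob_on_def)
  ultimately show ?thesis
    using g l ac by blast
qed

end
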